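(* Let $q\in\mathbb{N}$ be fixed, let $\langle M\rangle=\mathsf{E}_{\boldsymbol z}(M_\lambda)>0$ be fixed, and let $\langle N\rangle=\mathsf{E}_{\boldsymbol z}(N_\lambda)\to\infty$. Then the following hold under the Boltzmann distribution $\mathsf{P}_{\boldsymbol z}$ on $\check\Lambda^q$. (a) The distribution of $M_\lambda$ converges to the Poisson distribution with parameter $\langle M\rangle$: $$\mathsf{P}_{\boldsymbol z}(M_\lambda=m)\to\pi_m:=\frac{\langle M\rangle^m e^{-\langle M\rangle}}{m!},\qquad m\in\{0,1,2,\dots\}.$$ (b) For each $m\ge1$, the conditional distribution of the weight $N_\lambda$ given $M_\lambda=m$ converges to the gamma distribution with shape parameter $m/q$: $$\mathsf{P}_{\boldsymbol z}(\gamma N_\lambda\le x\mid M_\lambda=m)\to G_{m/q}(x)=\frac{1}{\Gamma(m/q)}\int_0^x u^{m/q-1}e^{-u}\,du,\qquad x\ge0,$$ and this convergence is uniform in $x\ge0$. (c) The marginal (unconditional) distribution function $G(x)=\lim_{\langle N\rangle\to\infty}\mathsf{P}_{\boldsymbol z}(\gamma N_\lambda\le x)$, with atom $G(0)=\pi_0=e^{-\langle M\rangle}$ at zero, is determined by its Laplace transform $$\phi(s)=\exp\left\{-\langle M\rangle\bigl(1-(1+s)^{-1/q}\bigr)\right\},\qquad s\ge0.$$ Furthermore, conditioned on $M_\lambda>0$, the Laplace transform becomes $$\tilde\phi(s)=\frac{e^{-\langle M\rangle}}{1-e^{-\langle M\rangle}}\left(\exp\left\{\frac{\langle M\rangle}{(1+s)^{1/q}}\right\}-1\right),\qquad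 s\ge0.$$
   Context: $\mathbb{N}=\{1,2,\dots\}$, $\mathbb{N}^q=\{j^q: j\in\mathbb{N}\}$. $\check{\Lambda}^q$ is the set of all strict integer partitions into $q$-th powers, i.e. finite (possibly empty) sequences $\lambda_1>\lambda_2>\cdots$ of distinct elements of $\mathbb{N}^q$. For $\lambda\in\check\Lambda^q$ and $\ell\in\mathbb{N}^q$, $\nu_\ell\in\{0,1\}$ is the multiplicity of the part $\ell$ in $\lambda$; the weight is $N_\lambda=\sum_{\ell}\ell\nu_\ell$ and the length is $M_\lambda=\sum_{\ell}\nu_\ell$. For $\boldsymbol z=(z_1,z_2)$ with $0<z_1<1$, $z_2>0$, the Boltzmann distribution on $\check\Lambda^q$ is $\mathsf{P}_{\boldsymbol z}(\lambda)=z_1^{N_\lambda}z_2^{M_\lambda}/F(\boldsymbol z)$, where $F(\boldsymbol z)=\sum_{\lambda\in\check\Lambda^q}z_1^{N_\lambda}z_2^{M_\lambda}$; $\mathsf{E}_{\boldsymbol z}$ is the corresponding expectation. Given real hyper-parameters $\langle N\rangle,\langle M\rangle>0$, the parameter $\boldsymbol z$ is calibrated as the root of $\mathsf{E}_{\boldsymbol z}(N_\lambda)=\langle N\rangle$, $\mathsf{E}_{\boldsymbol z}(M_\lambda)=\langle M\rangle$, so $\boldsymbol z$ and $\mathsf{P}_{\boldsymbol z}$ depend on the hyper-parameters; with $\kappa:=\langle M\rangle^{q+1}/\langle N\rangle\to0$ it satisfies $z_1=\exp\bigl(-\frac{\langle M\rangle}{q\langle N\rangle}(1+O(\kappa^{1/q}))\bigr)$,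 $z_2=\frac{\kappa^{1/q}}{q^{1/q}\Gamma(1+1/q)}(1+O(\kappa^{1/q}))$. Notation: $\gamma:=-\log z_1$. *)

theory Defs
  imports "HOL-Probability.Probability"
begin

definition qpowers :: "nat \<Rightarrow> nat set" where
  "qpowers q = {j ^ q | j. 1 \<le> j}"

definition strict_partitions :: "nat \<Rightarrow> nat list set" where
  "strict_partitions q = {p. sorted_wrt (>) p \<and> set p \<subseteq> qpowers q}"

definition weight :: "nat list \<Rightarrow> nat" where
  "weight p = sum_list p"

definition partition_fun :: "nat \<Rightarrow> real \<Rightarrow> real \<Rightarrow> real" where
  "partition_fun q z1 z2 =
     (\<Sum>\<^sub>\<infinity>p\<in>strict_partitions q. z1 ^ weight p * z2 ^ length p)"

text \<open>For \<open>0 < z1 < 1\<close> and \<open>0 < z2\<close> the sum above converges and this is a probability measure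
  on the countable set of strict partitions, with every subset measurable.\<close>

definition boltzmann :: "nat \<Rightarrow> real \<Rightarrow> real \<Rightarrow> nat list measure" where
  "boltzmann q z1 z2 = point_measure (strict_partitions q)
     (\<lambda>p. ennreal (z1 ^ weight p * z2 ^ length p / partition_fun q z1 z2))"

text \<open>\<open>(z1, z2)\<close> is an admissible root of the calibration equations for the
  hyper-parameters \<open>N\<close> (expected weight) and \<open>M\<close> (expected length).\<close>

definition calibrated :: "nat \<Rightarrow> real \<Rightarrow> real \<Rightarrow> real \<Rightarrow> real \<Rightarrow> bool" where
  "calibrated q N M z1 z2 \<longleftrightarrow>
     0 < z1 \<and> z1 < 1 \<and> 0 < z2 \<and>
     (\<integral>p. real (weight p) \<partial>boltzmann q z1 z2) = N \<and>
     (\<integral>p. real (length p) \<partial>boltzmann q z1 z2) = M"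

definition gamma_cdf :: "real \<Rightarrow> real \<Rightarrow> real" where
  "gamma_cdf a x = 1 / Gamma a * integral {0..x} (\<lambda>u. u powr (a - 1) * exp (- u))"

definition nonneg_distribution :: "real measure \<Rightarrow> bool" where
  "nonneg_distribution \<mu> \<longleftrightarrow> real_distribution \<mu> \<and> measure \<mu> {..<0} = 0"

definition laplace :: "real measure \<Rightarrow> real \<Rightarrow> real" where
  "laplace \<mu> s = (\<integral>x. exp (- s * x) \<partial>\<mu>)"

end

theory Submission
  imports Defs
begin

text \<open>
  Write \<open>\<gamma> = - ln z\<^sub>1\<close> and give a finite set \<open>S\<close> of parts the weight \<open>\<Prod>l\<in>S. z\<^sub>2 * exp (- \<gamma> * l)\<close>.
  Counting pairs (partition, marked part) in two ways shows that the total weight \<open>E\<^sub>m\<close> of the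
  partitions of length \<open>m\<close> satisfies \<open>(m + 1) * E\<^sub>m\<^sub>+\<^sub>1 = (p + O(m * z\<^sub>2)) * E\<^sub>m\<close>, where \<open>p\<close> is the total weight
  of the one-part partitions. The calibration equations with \<open>N \<rightarrow> \<infinity>\<close> force \<open>\<gamma> \<rightarrow> 0\<close>, then
  \<open>z\<^sub>2 \<rightarrow> 0\<close> and \<open>p \<rightarrow> M\<close>, so that \<open>E\<^sub>m \<rightarrow> M ^ m / m!\<close>, which is (a).

  Inserting \<open>exp (- s * \<gamma> * weight)\<close> only replaces \<open>\<gamma>\<close> by \<open>(1 + s) * \<gamma>\<close>. A comparison of sum and
  integral gives \<open>p \<rightarrow> M * (1 + s) powr (- 1 / q)\<close> for the new parameter, so the conditional
  Laplace transform tends to \<open>(1 + s) powr (- m / q)\<close>, that of the gamma law. Since polynomials in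
  \<open>exp (- x)\<close> are uniformly dense, by Weierstrass, this gives convergence of the distribution
  functions; it is uniform because the limit is continuous. Summing over \<open>m\<close> by dominated
  convergence yields the Poisson mixture of gamma laws in (c).
\<close>

section \<open>Laplace transforms and convergence of distribution functions\<close>

text \<open>The parameters are accessible only through two mean values, so no bound on
  \<open>z2\<close> is known in advance and every estimate has to survive large \<open>z2\<close>.
  The tool is the exact occupation number \<open>a / (1 + a)\<close> of a part of weight
  \<open>a\<close>: summed over the \<open>K\<close> smallest parts it stays below \<open>M\<close>.
  This caps the weight of one fixed part, which keeps the mean weight bounded as long as
  \<open>\<gamma>\<close> stays away from 0. Once \<open>\<gamma>\<close> is small, a value of
  \<open>z2\<close> above \<open>e\<close> would give \<open>K\<close> fixed parts occupation
  numbers bounded from below, impossible for large \<open>K\<close>. The second obstacle is the atom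
  of the limit law at 0: Laplace transforms control distribution functions at continuity points
  only, yet the limit in (c) is proved at every \<open>x\<close>. Hence each length is treated
  separately, where length 0 is explicit and length \<open>m \<ge> 1\<close> has a continuous limit,
  and the slices are then summed against the dominating series \<open>(M + 1) ^ k / fact k\<close>.
  All sums run over finite sets of parts; strictly decreasing lists enter only through the bijection
  \<open>set\<close>.\<close>

lemma tendsto_integral_of_laplace:
  fixes \<nu> :: "'i \<Rightarrow> 'a measure" and X :: "'i \<Rightarrow> 'a \<Rightarrow> real" and \<mu> :: "real measure"
    and g :: "real \<Rightarrow> real"
  assumes \<nu>: "\<forall>\<^sub>F i in F. finite_measure (\<nu> i) \<and> X i \<in> borel_measurable (\<nu> i) \<and> (AE p in \<nu> i. 0 \<le> X i p)"
    and \<mu>: "finite_measure \<mu>" "sets \<mu> = sets borel" "AE x in \<mu>. 0 \<le> x"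
    and lim: "\<And>k::nat. ((\<lambda>i. \<integral>p. exp (- real k * X i p) \<partial>\<nu> i) \<longlongrightarrow> laplace \<mu> (real k)) F"
    and g: "continuous_on UNIV g"
  shows "((\<lambda>i. \<integral>p. g (exp (- X i p)) \<partial>\<nu> i) \<longlongrightarrow> (\<integral>x. g (exp (- x)) \<partial>\<mu>)) F"
proof (rule tendstoI)
  fix e :: real assume "e > 0"
  have [measurable]: "g \<in> borel_measurable borel"
    using g by (rule borel_measurable_continuous_onI)
  define m where "m = measure \<mu> (space \<mu>)"
  \<comment> \<open>The factor \<open>m + 1\<close> bounds the mass of \<open>\<mu>\<close> and,
    eventually, that of \<open>\<nu> i\<close>. The thirds of \<open>e\<close> pay for replacing
    \<open>g\<close> by a polynomial on either side and for the convergence of the polynomial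
    integrals.\<close>
  define d where "d = e / (3 * (m + 1))"
  have "m \<ge> 0" by (simp add: m_def)
  with \<open>e > 0\<close> have "d > 0" by (simp add: d_def)
  \<comment> \<open>\<open>exp (- X)\<close> takes its values in [0,1], and the integral of its k-th
    power is the Laplace transform at \<open>k\<close>; this is why integer arguments determine
    everything.\<close>
  obtain h where h: "real_polynomial_function h" "\<And>x. x \<in> {0..1} \<Longrightarrow> \<bar>g x - h x\<bar> < d"
    using Stone_Weierstrass_real_polynomial_function[OF compact_Icc continuous_on_subset[OF g subset_UNIV] \<open>d > 0\<close>]
    by blast
  obtain a n where h_eq: "h = (\<lambda>x. \<Sum>k\<le>n. a k * x ^ k)"
    using h(1) by (auto simp: real_polynomial_function_iff_sum)
  have [measurable]: "h \<in> borel_measurable borel"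
    unfolding h_eq by measurable
  \<comment> \<open>Stated for an arbitrary finite measure, because it is applied both to
    \<open>\<nu> i\<close> and to \<open>\<mu>\<close>.\<close>
  have approx: "\<bar>(\<integral>p. g (exp (- Y p)) \<partial>M) - (\<integral>p. h (exp (- Y p)) \<partial>M)\<bar> \<le> d * measure M (space M)"
    and poly: "(\<integral>p. h (exp (- Y p)) \<partial>M) = (\<Sum>k\<le>n. a k * (\<integral>p. exp (- real k * Y p) \<partial>M))"
    if "finite_measure M" and Y [measurable]: "Y \<in> borel_measurable M" and nn: "AE p in M. 0 \<le> Y p"
    for M and Y :: "'b \<Rightarrow> real"
  proof -
    interpret finite_measure M by fact
    have int_exp: "integrable M (\<lambda>p. exp (- real k * Y p))" for k :: nat
      by (rule integrable_const_bound[where B=1]) (use nn in auto)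
    have hY: "h (exp (- Y p)) = (\<Sum>k\<le>n. a k * exp (- real k * Y p))" for p
      by (simp add: h_eq exp_of_nat_mult [symmetric])
    have int_h: "integrable M (\<lambda>p. h (exp (- Y p)))"
      unfolding hY by (intro Bochner_Integration.integrable_sum integrable_mult_right int_exp)
    \<comment> \<open>The closeness of \<open>g\<close> and \<open>h\<close> holds on [0,1] only, so
      the difference is bounded almost everywhere; integrability of \<open>g (exp (- Y p))\<close>
      is then read off from that of \<open>h\<close>.\<close>
    have int_d: "integrable M (\<lambda>p. g (exp (- Y p)) - h (exp (- Y p)))"
    proof (rule integrable_const_bound[where B=d])
      show "AE p in M. norm (g (exp (- Y p)) - h (exp (- Y p))) \<le> d"
        using nn by eventually_elim (use h(2) in \<open>auto intro: less_imp_le\<close>)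
    qed auto
    have int_g: "integrable M (\<lambda>p. g (exp (- Y p)))"
      using Bochner_Integration.integrable_add[OF int_d int_h] by simp
    have "\<bar>(\<integral>p. g (exp (- Y p)) \<partial>M) - (\<integral>p. h (exp (- Y p)) \<partial>M)\<bar>
        = \<bar>\<integral>p. g (exp (- Y p)) - h (exp (- Y p)) \<partial>M\<bar>"
      using int_g int_h by simp
    also have "\<dots> \<le> (\<integral>p. \<bar>g (exp (- Y p)) - h (exp (- Y p))\<bar> \<partial>M)"
      using integral_norm_bound[of M "\<lambda>p. g (exp (- Y p)) - h (exp (- Y p))"] by simp
    also have "\<dots> \<le> (\<integral>p. d \<partial>M)"
    proof (rule integral_mono_AE)
      show "AE p in M. \<bar>g (exp (- Y p)) - h (exp (- Y p))\<bar> \<le> d"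
        using nn by eventually_elim (use h(2) in \<open>auto intro: less_imp_le\<close>)
    qed (use int_d in auto)
    finally show "\<bar>(\<integral>p. g (exp (- Y p)) \<partial>M) - (\<integral>p. h (exp (- Y p)) \<partial>M)\<bar> \<le> d * measure M (space M)"
      by (simp add: mult.commute)
    show "(\<integral>p. h (exp (- Y p)) \<partial>M) = (\<Sum>k\<le>n. a k * (\<integral>p. exp (- real k * Y p) \<partial>M))"
      unfolding hY using int_exp by (subst Bochner_Integration.integral_sum) auto
  qed
  have id_meas: "(\<lambda>x. x) \<in> borel_measurable \<mu>"
    using \<mu>(2) by (simp add: measurable_ident_sets)
  have limh: "((\<lambda>i. \<Sum>k\<le>n. a k * (\<integral>p. exp (- real k * X i p) \<partial>\<nu> i)) \<longlongrightarrow> (\<Sum>k\<le>n. a k * laplace \<mu> (real k))) F"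
    by (intro tendsto_intros lim)
  \<comment> \<open>At \<open>k = 0\<close> the hypothesis is convergence of the total
    masses.\<close>
  have limm: "((\<lambda>i. measure (\<nu> i) (space (\<nu> i))) \<longlongrightarrow> m) F"
    using lim[of 0] by (simp add: laplace_def m_def)
  have ev1: "\<forall>\<^sub>F i in F. measure (\<nu> i) (space (\<nu> i)) < m + 1"
    using order_tendstoD(2)[OF limm, of "m + 1"] by simp
  have ev2: "\<forall>\<^sub>F i in F. \<bar>(\<Sum>k\<le>n. a k * (\<integral>p. exp (- real k * X i p) \<partial>\<nu> i)) - (\<Sum>k\<le>n. a k * laplace \<mu> (real k))\<bar> < e / 3"
    using tendstoD[OF limh, of "e / 3"] \<open>e > 0\<close> by (simp add: dist_real_def)
  show "\<forall>\<^sub>F i in F. dist (\<integral>p. g (exp (- X i p)) \<partial>\<nu> i) (\<integral>x. g (exp (- x)) \<partial>\<mu>) < e"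
    using \<nu> ev1 ev2
  proof eventually_elim
    case (elim i)
    have i: "finite_measure (\<nu> i)" "X i \<in> borel_measurable (\<nu> i)" "AE p in \<nu> i. 0 \<le> X i p"
      using elim by auto
    have "\<bar>(\<integral>p. g (exp (- X i p)) \<partial>\<nu> i) - (\<integral>p. h (exp (- X i p)) \<partial>\<nu> i)\<bar> \<le> d * (m + 1)"
      using approx[OF i] elim(2) \<open>d > 0\<close> by (smt (verit) mult_less_cancel_left_pos)
    moreover have "\<bar>(\<integral>x. g (exp (- x)) \<partial>\<mu>) - (\<integral>x. h (exp (- x)) \<partial>\<mu>)\<bar> \<le> d * (m + 1)"
      using approx[OF \<mu>(1) id_meas \<mu>(3)] \<open>d > 0\<close> by (simp add: m_def algebra_simps)
    moreover have "d * (m + 1) = e / 3"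
      using \<open>m \<ge> 0\<close> by (simp add: d_def field_simps)
    ultimately show ?case
      using elim(3) poly[OF i] poly[OF \<mu>(1) id_meas \<mu>(3)]
      unfolding dist_real_def laplace_def by linarith
  qed
qed

text \<open>The test function is a function of \<open>t = exp (- x)\<close>, continuous up to
  \<open>t = 0\<close>, that is \<open>x = \<infinity>\<close>. This is the class covered by
  \<open>tendsto_integral_of_laplace\<close>, and it builds the compactification at infinity into
  the test functions.\<close>

definition cutoff :: "real \<Rightarrow> real \<Rightarrow> (real \<Rightarrow> real) \<Rightarrow> bool" where
  "cutoff y z g \<longleftrightarrow> continuous_on UNIV g \<and> (\<forall>t. 0 \<le> g t) \<and> (\<forall>t. g t \<le> 1) \<and>
    (\<forall>x\<le>y. g (exp (- x)) = 1) \<and> (\<forall>x\<ge>z. g (exp (- x)) = 0)"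

lemma exists_cutoff:
  fixes y z :: real
  assumes "y < z"
  shows "\<exists>g. cutoff y z g"
proof -
  define g where "g t = max 0 (min 1 ((t - exp (- z)) / (exp (- y) - exp (- z))))" for t
  have pos: "exp (- y) - exp (- z) > 0" using assms by simp
  have "continuous_on UNIV g"
    unfolding g_def using pos by (intro continuous_intros) auto
  moreover have "0 \<le> g t" "g t \<le> 1" for t by (auto simp: g_def)
  moreover have "g (exp (- x)) = 1" if "x \<le> y" for x
    using that pos by (simp add: g_def)
  moreover have "g (exp (- x)) = 0" if "z \<le> x" for x
  proof -
    have "(exp (- x) - exp (- z)) / (exp (- y) - exp (- z)) \<le> 0"
      using that pos by (intro divide_nonpos_pos) auto
    then show ?thesis by (simp add: g_def)
  qed
  ultimately show ?thesis unfolding cutoff_def by blast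
qed

text \<open>The composition with \<open>exp (- X)\<close> lies between the indicators of
  \<open>X p \<le> y\<close> and \<open>X p \<le> z\<close>. This turns limits of integrals into
  bounds on distribution functions.\<close>

lemma (in finite_measure) cutoff_bounds:
  fixes X :: "'a \<Rightarrow> real" and g :: "real \<Rightarrow> real"
  assumes [measurable]: "X \<in> borel_measurable M" and "cutoff y z g"
  shows "measure M {p \<in> space M. X p \<le> y} \<le> (\<integral>p. g (exp (- X p)) \<partial>M)"
    and "(\<integral>p. g (exp (- X p)) \<partial>M) \<le> measure M {p \<in> space M. X p \<le> z}"
proof -
  have g: "continuous_on UNIV g" and g01: "\<And>t. 0 \<le> g t" "\<And>t. g t \<le> 1"
    and g1: "\<And>x. x \<le> y \<Longrightarrow> g (exp (- x)) = 1" and g0: "\<And>x. z \<le> x \<Longrightarrow> g (exp (- x)) = 0"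
    using assms(2) by (auto simp: cutoff_def)
  have [measurable]: "g \<in> borel_measurable borel"
    using g by (rule borel_measurable_continuous_onI)
  have int: "integrable M (\<lambda>p. g (exp (- X p)))"
    by (rule integrable_const_bound[where B=1]) (use g01 in auto)
  have ind: "integrable M (\<lambda>p. indicator {p \<in> space M. X p \<le> c} p :: real)" for c
    by (rule integrable_const_bound[where B=1]) (auto simp: indicator_def)
  have eq: "measure M {p \<in> space M. X p \<le> c} = (\<integral>p. indicator {p \<in> space M. X p \<le> c} p \<partial>M)" for c
    by simp
  show "measure M {p \<in> space M. X p \<le> y} \<le> (\<integral>p. g (exp (- X p)) \<partial>M)"
    unfolding eq by (rule integral_mono[OF ind int]) (use g01 g1 in \<open>auto simp: indicator_def\<close>)
  show "(\<integral>p. g (exp (- X p)) \<partial>M) \<le> measure M {p \<in> space M. X p \<le> z}"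
    unfolding eq by (rule integral_mono[OF int ind]) (use g01 g0 in \<open>auto simp: indicator_def\<close>)
qed

text \<open>The lower bound uses a cutoff that descends just to the left of \<open>x\<close>, the
  upper bound one that descends just to the right. Continuity of \<open>cdf \<mu>\<close> at
  \<open>x\<close> makes the loss on either side arbitrarily small.\<close>

lemma laplace_continuity:
  fixes \<nu> :: "'i \<Rightarrow> 'a measure" and X :: "'i \<Rightarrow> 'a \<Rightarrow> real"
  assumes \<nu>: "\<forall>\<^sub>F i in F. finite_measure (\<nu> i) \<and> X i \<in> borel_measurable (\<nu> i) \<and> (AE p in \<nu> i. 0 \<le> X i p)"
    and \<mu>: "finite_borel_measure \<mu>" "AE x in \<mu>. 0 \<le> x"
    and lim: "\<And>k::nat. ((\<lambda>i. \<integral>p. exp (- real k * X i p) \<partial>\<nu> i) \<longlongrightarrow> laplace \<mu> (real k)) F"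
    and x: "measure \<mu> {x} = 0"
  shows "((\<lambda>i. measure (\<nu> i) {p \<in> space (\<nu> i). X i p \<le> x}) \<longlongrightarrow> cdf \<mu> x) F"
proof -
  interpret \<mu>: finite_borel_measure \<mu> by fact
  have \<mu>': "finite_measure \<mu>" "sets \<mu> = sets borel" by (fact \<mu>.finite_measure_axioms, fact \<mu>.M_is_borel)
  have id_meas: "(\<lambda>x. x) \<in> borel_measurable \<mu>"
    using \<mu>'(2) by (simp add: measurable_ident_sets)
  have cdf_eq: "measure \<mu> {t \<in> space \<mu>. t \<le> y} = cdf \<mu> y" for y
    using sets_eq_imp_space_eq[OF \<mu>'(2)] by (simp add: cdf_def atMost_def)
  have cont: "isCont (cdf \<mu>) x" using x by (simp add: \<mu>.isCont_cdf)
  show ?thesis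
  proof (rule order_tendstoI)
    fix c assume c: "c < cdf \<mu> x"
    have "(cdf \<mu> \<longlongrightarrow> cdf \<mu> x) (at_left x)"
      using cont by (simp add: isCont_def filterlim_at_split)
    then have "\<forall>\<^sub>F y in at_left x. c < cdf \<mu> y" using c by (rule order_tendstoD)
    moreover have "\<forall>\<^sub>F y in at_left x. y < x" by (simp add: eventually_at_filter)
    ultimately obtain y where y: "y < x" "c < cdf \<mu> y"
      by (metis (mono_tags, lifting) eventually_conj eventually_happens trivial_limit_at_left_real)
    obtain g where g: "cutoff y x g"
      using exists_cutoff[OF y(1)] by blast
    then have g_cont: "continuous_on UNIV g" by (simp add: cutoff_def)
    have "c < (\<integral>x. g (exp (- x)) \<partial>\<mu>)"
      using \<mu>.cutoff_bounds(1)[OF id_meas g] y(2) cdf_eq by simp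
    then have "\<forall>\<^sub>F i in F. c < (\<integral>p. g (exp (- X i p)) \<partial>\<nu> i)"
      using order_tendstoD(1)[OF tendsto_integral_of_laplace[OF \<nu> \<mu>' \<mu>(2) lim g_cont]] by blast
    with \<nu> show "\<forall>\<^sub>F i in F. c < measure (\<nu> i) {p \<in> space (\<nu> i). X i p \<le> x}"
    proof eventually_elim
      case (elim i)
      then show ?case using finite_measure.cutoff_bounds(2)[OF _ _ g, of "\<nu> i" "X i"] by linarith
    qed
  next
    fix c assume c: "cdf \<mu> x < c"
    have "(cdf \<mu> \<longlongrightarrow> cdf \<mu> x) (at_right x)"
      using cont by (simp add: isCont_def filterlim_at_split)
    then have "\<forall>\<^sub>F y in at_right x. cdf \<mu> y < c" using c by (rule order_tendstoD)
    moreover have "\<forall>\<^sub>F y in at_right x. x < y" by (simp add: eventually_at_filter)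
    ultimately obtain y where y: "x < y" "cdf \<mu> y < c"
      by (metis (mono_tags, lifting) eventually_conj eventually_happens trivial_limit_at_right_real)
    obtain g where g: "cutoff x y g"
      using exists_cutoff[OF y(1)] by blast
    then have g_cont: "continuous_on UNIV g" by (simp add: cutoff_def)
    have "(\<integral>x. g (exp (- x)) \<partial>\<mu>) < c"
      using \<mu>.cutoff_bounds(2)[OF id_meas g] y(2) cdf_eq by simp
    then have "\<forall>\<^sub>F i in F. (\<integral>p. g (exp (- X i p)) \<partial>\<nu> i) < c"
      using order_tendstoD(2)[OF tendsto_integral_of_laplace[OF \<nu> \<mu>' \<mu>(2) lim g_cont]] by blast
    with \<nu> show "\<forall>\<^sub>F i in F. measure (\<nu> i) {p \<in> space (\<nu> i). X i p \<le> x} < c"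
    proof eventually_elim
      case (elim i)
      then show ?case using finite_measure.cutoff_bounds(1)[OF _ _ g, of "\<nu> i" "X i"] by linarith
    qed
  qed
qed

section \<open>Uniqueness of Laplace transforms of nonnegative laws\<close>

lemma nonneg_distribution_AE:
  assumes "nonneg_distribution \<mu>"
  shows "AE x in \<mu>. 0 \<le> x"
proof -
  interpret real_distribution \<mu> using assms by (simp add: nonneg_distribution_def)
  have "{..<0} \<in> null_sets \<mu>"
    using assms by (auto simp: nonneg_distribution_def null_sets_def emeasure_eq_measure)
  then show ?thesis
    by (rule AE_I') auto
qed

text \<open>Applied to a constant family, the convergence of cutoff integrals is an equality between
  them. It yields \<open>cdf \<mu> x \<le> cdf \<nu> z\<close> for \<open>x < z\<close>, hence also
  for \<open>z = x\<close> by right continuity, and the two laws can be exchanged.\<close>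

lemma laplace_unique:
  assumes \<mu>: "nonneg_distribution \<mu>" and \<nu>: "nonneg_distribution \<nu>"
    and eq: "\<And>s. 0 \<le> s \<Longrightarrow> laplace \<mu> s = laplace \<nu> s"
  shows "\<mu> = \<nu>"
proof -
  have le: "cdf \<mu> x \<le> cdf \<nu> x"
    if \<mu>: "nonneg_distribution \<mu>" and \<nu>: "nonneg_distribution \<nu>"
      and eq: "\<And>s. 0 \<le> s \<Longrightarrow> laplace \<mu> s = laplace \<nu> s" for \<mu> \<nu> x
  proof -
    interpret \<mu>: real_distribution \<mu> using \<mu> by (simp add: nonneg_distribution_def)
    interpret \<nu>: real_distribution \<nu> using \<nu> by (simp add: nonneg_distribution_def)
    have meas: "(\<lambda>x. x) \<in> borel_measurable \<mu>" "(\<lambda>x. x) \<in> borel_measurable \<nu>"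
      by (simp_all add: measurable_ident_sets)
    have fin: "finite_measure \<mu>" "finite_measure \<nu>" by unfold_locales
    have "cdf \<mu> x \<le> cdf \<nu> z" if xz: "x < z" for z
    proof -
      obtain g where g: "cutoff x z g"
      using exists_cutoff[OF xz] by blast
    then have g_cont: "continuous_on UNIV g" by (simp add: cutoff_def)
      have "((\<lambda>_. \<integral>p. g (exp (- p)) \<partial>\<mu>) \<longlongrightarrow> (\<integral>x. g (exp (- x)) \<partial>\<nu>)) sequentially"
      proof (rule tendsto_integral_of_laplace[OF always_eventually fin(2) \<nu>.M_is_borel _ _ g_cont])
        show "\<forall>_. finite_measure \<mu> \<and> (\<lambda>x. x) \<in> borel_measurable \<mu> \<and> (AE x in \<mu>. 0 \<le> x)"
          using fin(1) meas(1) nonneg_distribution_AE[OF \<mu>] by blast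
        show "AE x in \<nu>. 0 \<le> x" by (rule nonneg_distribution_AE[OF \<nu>])
        show "((\<lambda>i. \<integral>p. exp (- real k * p) \<partial>\<mu>) \<longlongrightarrow> laplace \<nu> (real k)) sequentially" for k
          using eq[of "real k"] by (simp add: laplace_def)
      qed
      then have "(\<integral>p. g (exp (- p)) \<partial>\<mu>) = (\<integral>x. g (exp (- x)) \<partial>\<nu>)"
        by (simp add: LIMSEQ_const_iff)
      moreover have "cdf \<mu> x \<le> (\<integral>p. g (exp (- p)) \<partial>\<mu>)"
        using \<mu>.cutoff_bounds(1)[OF meas(1) g] by (simp add: cdf_def atMost_def)
      moreover have "(\<integral>p. g (exp (- p)) \<partial>\<nu>) \<le> cdf \<nu> z"
        using \<nu>.cutoff_bounds(2)[OF meas(2) g] by (simp add: cdf_def atMost_def)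
      ultimately show ?thesis by simp
    qed
    moreover have "(cdf \<nu> \<longlongrightarrow> cdf \<nu> x) (at_right x)"
      using \<nu>.cdf_is_right_cont[of x] by (simp add: continuous_within)
    ultimately show ?thesis
      by (intro tendsto_lowerbound[where F = "at_right x" and f = "cdf \<nu>"])
         (auto simp: eventually_at_right_less intro: eventually_mono[OF eventually_at_right_less])
  qed
  have "cdf \<mu> = cdf \<nu>"
    using le[OF \<mu> \<nu> eq] le[OF \<nu> \<mu> eq[symmetric]] by (intro ext antisym) auto
  then show ?thesis
    using \<mu> \<nu> by (intro cdf_unique) (auto simp: nonneg_distribution_def)
qed

text \<open>Polya's argument: on \<open>{0..R}\<close> monotonicity transfers closeness at the
  points of a fine grid to the points between them, and to the right of \<open>R\<close> both
  functions are caught between a value near 1 and 1 itself.\<close>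

lemma uniform_limit_of_mono:
  fixes f :: "'i \<Rightarrow> real \<Rightarrow> real" and G :: "real \<Rightarrow> real"
  assumes f: "\<forall>\<^sub>F i in F. mono (f i) \<and> (\<forall>x. f i x \<le> 1)"
    and lim: "\<And>x. 0 \<le> x \<Longrightarrow> ((\<lambda>i. f i x) \<longlongrightarrow> G x) F"
    and G: "continuous_on {0..} G" "mono_on {0..} G" "(G \<longlongrightarrow> 1) at_top"
  shows "uniform_limit {0..} f G F"
proof (rule uniform_limitI)
  fix e :: real assume "e > 0"
  have "\<forall>\<^sub>F x in at_top. 1 - e / 2 < G x"
    using order_tendstoD(1)[OF G(3), of "1 - e / 2"] \<open>e > 0\<close> by simp
  then have "\<forall>\<^sub>F x in at_top. 0 < x \<and> 1 - e / 2 < G x"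
    by (intro eventually_conj eventually_gt_at_top)
  then obtain R where R: "R > 0" "1 - e / 2 < G R"
    by (auto simp: eventually_at_top_linorder)
  have "uniformly_continuous_on {0..R} G"
    by (intro compact_uniformly_continuous continuous_on_subset[OF G(1)]) auto
  then obtain d where d: "d > 0"
    "\<And>x y. x \<in> {0..R} \<Longrightarrow> y \<in> {0..R} \<Longrightarrow> dist y x < d \<Longrightarrow> dist (G y) (G x) < e / 2"
    using half_gt_zero[OF \<open>e > 0\<close>] unfolding uniformly_continuous_on_def by blast
  obtain n :: nat where n: "n > 0" "R / n < d"
  proof -
    obtain n :: nat where n: "R / d < n" using reals_Archimedean2 by blast
    moreover have "R / d > 0" using R d by simp
    ultimately have "real n > 0" by linarith
    with n d(1) that[of n] show ?thesis by (simp add: field_simps)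
  qed
  define x where "x k = R * real k / real n" for k
  have xR: "x k \<in> {0..R}" if "k \<le> n" for k
    using that R n by (auto simp: x_def divide_le_eq intro!: mult_left_mono)
  have grid: "\<forall>\<^sub>F i in F. \<forall>k\<in>{..n}. \<bar>f i (x k) - G (x k)\<bar> < e / 2"
  proof (intro eventually_ball_finite ballI)
    fix k assume "k \<in> {..n}"
    then show "\<forall>\<^sub>F i in F. \<bar>f i (x k) - G (x k)\<bar> < e / 2"
      using tendstoD[OF lim[of "x k"], of "e / 2"] xR[of k] \<open>e > 0\<close> by (simp add: dist_real_def)
  qed auto
  have G1: "G t \<le> 1" if "0 \<le> t" for t
  proof (rule tendsto_lowerbound[OF G(3)])
    show "\<forall>\<^sub>F s in at_top. G t \<le> G s"
      using eventually_ge_at_top[of t] by eventually_elim (use that G(2) in \<open>auto simp: mono_on_def\<close>)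
  qed auto
  show "\<forall>\<^sub>F i in F. \<forall>t\<in>{0..}. dist (f i t) (G t) < e"
    using f grid
  proof eventually_elim
    case (elim i)
    have mono: "f i s \<le> f i t" if "s \<le> t" for s t using elim(1) that by (auto simp: mono_def)
    show ?case
    proof
      fix t :: real assume t: "t \<in> {0..}"
      show "dist (f i t) (G t) < e"
      proof (cases "t < R")
        case False
        \<comment> \<open>Both values lie in \<open>{1 - e<..1}\<close>: \<open>G R\<close> exceeds
          \<open>1 - e / 2\<close>, and \<open>f i R\<close> differs from it by less than
          \<open>e / 2\<close>.\<close>
        have "x n = R" using n by (simp add: x_def)
        then have "\<bar>f i R - G R\<bar> < e / 2" using elim(2) by (metis atMost_iff order_refl)
        moreover have "f i R \<le> f i t" using False mono by simp
        moreover have "f i t \<le> 1" using elim by auto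
        moreover have "G R \<le> G t" "G t \<le> 1"
          using False G1 t G(2) R(1) by (auto simp: mono_on_def)
        ultimately show ?thesis using R(2) unfolding dist_real_def by linarith
      next
        case True
        \<comment> \<open>The index of the grid cell that contains \<open>t\<close>;
          \<open>t < R\<close> guarantees that its right end \<open>Suc k\<close> is still at most
          \<open>n\<close>.\<close>
        define k where "k = nat \<lfloor>t * n / R\<rfloor>"
        have tn: "0 \<le> t * n / R" using t R by auto
        have k: "real k \<le> t * n / R" "t * n / R < real k + 1"
          unfolding k_def using tn by linarith+
        have "t * n / R < n" using True R n by (simp add: field_simps)
        then have kn: "k < n" using k by linarith
        have xk: "x k \<le> t" "t < x (Suc k)"
          using k R n by (auto simp: x_def field_simps)
        have diff: "x (Suc k) - x k = R / n" by (simp add: x_def algebra_simps add_divide_distrib)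
        have dists: "\<bar>G (x k) - G t\<bar> < e / 2" "\<bar>G (x (Suc k)) - G t\<bar> < e / 2"
          using d(2)[of t "x k"] d(2)[of t "x (Suc k)"] xR[of k] xR[of "Suc k"] kn t True xk diff n(2)
          by (auto simp: dist_real_def)
        have "\<bar>f i (x k) - G (x k)\<bar> < e / 2" "\<bar>f i (x (Suc k)) - G (x (Suc k))\<bar> < e / 2"
          using elim(2) kn by auto
        moreover have "f i (x k) \<le> f i t" "f i t \<le> f i (x (Suc k))"
          using mono xk by auto
        ultimately show ?thesis using dists unfolding dist_real_def by linarith
      qed
    qed
  qed
qed

section \<open>Gamma distributions and their Poisson mixture\<close>

definition gamma_density :: "real \<Rightarrow> real \<Rightarrow> real" where
  "gamma_density a x = (if 0 < x then x powr (a - 1) * exp (- x) / Gamma a else 0)"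

definition gamma_measure :: "real \<Rightarrow> real measure" where
  "gamma_measure a = density lborel (\<lambda>x. ennreal (gamma_density a x))"

lemma gamma_density_nonneg: "0 < a \<Longrightarrow> 0 \<le> gamma_density a x"
  by (simp add: gamma_density_def Gamma_real_pos less_imp_le)

lemma measurable_gamma_density [measurable]: "gamma_density a \<in> borel_measurable borel"
  unfolding gamma_density_def by measurable

lemma has_bochner_integral_gamma_density:
  assumes "0 < a"
  shows "has_bochner_integral lborel (gamma_density a) 1"
proof -
  have G: "Gamma a > 0" using assms by (rule Gamma_real_pos)
  have "((\<lambda>t. t powr (a - 1) / exp t / Gamma a) has_integral Gamma a / Gamma a) {0..}"
    by (intro has_integral_divide Gamma_integral_real assms)
  then have "(\<integral>\<^sup>+x. ennreal (x powr (a - 1) / exp x / Gamma a) * indicator {0..} x \<partial>lborel) = ennreal 1"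
    using G by (subst nn_integral_has_integral_lebesgue') auto
  also have "(\<integral>\<^sup>+x. ennreal (x powr (a - 1) / exp x / Gamma a) * indicator {0..} x \<partial>lborel)
      = (\<integral>\<^sup>+x. ennreal (gamma_density a x) \<partial>lborel)"
    by (intro nn_integral_cong) (auto simp: gamma_density_def indicator_def exp_minus divide_inverse)
  finally show ?thesis
    using assms by (intro has_bochner_integral_nn_integral) (auto intro: gamma_density_nonneg)
qed

lemma real_distribution_gamma_measure:
  assumes "0 < a"
  shows "real_distribution (gamma_measure a)"
proof -
  have "(\<integral>\<^sup>+x. ennreal (gamma_density a x) \<partial>lborel) = ennreal (integral\<^sup>L lborel (gamma_density a))"
    using has_bochner_integral_gamma_density[OF assms] assms
    by (intro nn_integral_eq_integral) (auto simp: has_bochner_integral_iff gamma_density_nonneg)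
  then have "prob_space (gamma_measure a)"
    using has_bochner_integral_gamma_density[OF assms]
    by (intro prob_spaceI) (simp add: gamma_measure_def emeasure_density has_bochner_integral_iff)
  then show ?thesis
    by (simp add: real_distribution_def real_distribution_axioms_def gamma_measure_def)
qed

lemma measure_gamma_measure:
  assumes "0 < a" and [measurable]: "B \<in> sets borel"
  shows "measure (gamma_measure a) B = (\<integral>x. indicator B x * gamma_density a x \<partial>lborel)"
proof -
  have "emeasure (gamma_measure a) B = (\<integral>\<^sup>+x. ennreal (indicator B x * gamma_density a x) \<partial>lborel)"
    unfolding gamma_measure_def
    by (subst emeasure_density) (auto intro!: nn_integral_cong simp: indicator_def)
  also have "\<dots> = ennreal (\<integral>x. indicator B x * gamma_density a x \<partial>lborel)"
    using has_bochner_integral_gamma_density[OF assms(1)] assms(1)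
      integrable_real_mult_indicator[of B lborel "gamma_density a"]
    by (intro nn_integral_eq_integral)
       (auto simp: has_bochner_integral_iff gamma_density_nonneg mult.commute)
  finally show ?thesis
    using assms(1) by (simp add: measure_def gamma_density_nonneg integral_nonneg)
qed

lemma measure_gamma_measure_singleton: "0 < a \<Longrightarrow> measure (gamma_measure a) {x} = 0"
proof -
  assume a: "0 < a"
  have "AE y in lborel. indicator {x} y * gamma_density a y = 0"
    using AE_lborel_singleton[of x] by eventually_elim (simp add: indicator_def)
  then have "(\<integral>y. indicator {x} y * gamma_density a y \<partial>lborel) = (\<integral>y. 0 \<partial>(lborel :: real measure))"
    by (intro integral_cong_AE) auto
  then show ?thesis using a by (simp add: measure_gamma_measure)
qed

lemma cdf_gamma_measure_neg:
  assumes "0 < a" "x \<le> 0"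
  shows "cdf (gamma_measure a) x = 0"
proof -
  have "(\<integral>y. indicator {..x} y * gamma_density a y \<partial>lborel) = (\<integral>y. 0 \<partial>(lborel :: real measure))"
    using assms by (intro Bochner_Integration.integral_cong) (auto simp: indicator_def gamma_density_def)
  then show ?thesis using assms by (simp add: cdf_def measure_gamma_measure)
qed

lemma nonneg_distribution_gamma_measure:
  assumes "0 < a"
  shows "nonneg_distribution (gamma_measure a)"
proof -
  have "(\<integral>y. indicator {..<0} y * gamma_density a y \<partial>lborel) = (\<integral>y. 0 \<partial>(lborel :: real measure))"
    by (intro Bochner_Integration.integral_cong) (auto simp: indicator_def gamma_density_def)
  then show ?thesis
    using assms by (simp add: nonneg_distribution_def real_distribution_gamma_measure measure_gamma_measure)
qed

lemma cdf_gamma_measure: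
  assumes "0 < a" "0 \<le> x"
  shows "cdf (gamma_measure a) x = gamma_cdf a x"
proof -
  let ?f = "\<lambda>u. u powr (a - 1) * exp (- u) / Gamma a"
  have G: "Gamma a > 0" using assms(1) by (rule Gamma_real_pos)
  have eq: "indicator {..x} y * gamma_density a y = indicator {0..x} y *\<^sub>R ?f y" for y
    by (auto simp: indicator_def gamma_density_def)
  have "integrable lborel (\<lambda>y. indicator {..x} y * gamma_density a y)"
    using has_bochner_integral_gamma_density[OF assms(1)]
    by (simp add: has_bochner_integral_iff integrable_real_mult_indicator mult.commute)
  then have int: "set_integrable lborel {0..x} ?f"
    unfolding set_integrable_def eq .
  have "cdf (gamma_measure a) x = (LINT y:{0..x}|lborel. ?f y)"
    using assms by (simp add: cdf_def measure_gamma_measure set_lebesgue_integral_def eq)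
  also have "\<dots> = integral {0..x} ?f"
    using int by (rule set_borel_integral_eq_integral)
  also have "\<dots> = gamma_cdf a x"
    by (simp add: gamma_cdf_def)
  finally show ?thesis .
qed

text \<open>Up to the constant \<open>(1 + s) powr (1 - a)\<close> the tilted density is the density
  itself at \<open>(1 + s) * x\<close>; the substitution contributes the remaining factor
  \<open>1 / (1 + s)\<close>.\<close>

lemma laplace_gamma_measure:
  assumes "0 < a" "0 \<le> s"
  shows "laplace (gamma_measure a) s = (1 + s) powr (- a)"
proof -
  have "laplace (gamma_measure a) s = (\<integral>x. gamma_density a x * exp (- s * x) \<partial>lborel)"
    unfolding laplace_def gamma_measure_def
    using assms by (subst integral_real_density) (auto simp: gamma_density_nonneg)
  also have "\<dots> = (\<integral>x. (1 + s) powr (1 - a) * gamma_density a (0 + (1 + s) * x) \<partial>lborel)"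
  proof (rule Bochner_Integration.integral_cong[OF refl])
    fix x :: real
    have "(1 + s) powr (1 - a) * ((1 + s) * x) powr (a - 1) = x powr (a - 1)" if "x > 0"
      using that assms by (simp add: powr_mult mult.assoc [symmetric] powr_add [symmetric])
    moreover have "0 < (1 + s) * x \<longleftrightarrow> 0 < x"
      using assms by (simp add: zero_less_mult_iff)
    ultimately show "gamma_density a x * exp (- s * x) = (1 + s) powr (1 - a) * gamma_density a (0 + (1 + s) * x)"
      using assms by (auto simp: gamma_density_def algebra_simps simp flip: exp_add)
  qed
  also have "\<dots> = (1 + s) powr (1 - a) * (\<integral>x. gamma_density a (0 + (1 + s) * x) \<partial>lborel)"
    by simp
  also have "(\<integral>x. gamma_density a (0 + (1 + s) * x) \<partial>lborel) = 1 / (1 + s)"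
    using lborel_integral_real_affine[of "1 + s" "gamma_density a" 0]
      has_bochner_integral_gamma_density[OF assms(1)] assms(2)
    by (simp add: has_bochner_integral_iff field_simps)
  also have "(1 + s) powr (1 - a) * (1 / (1 + s)) = (1 + s) powr (- a)"
    using assms by (simp add: powr_diff powr_minus field_simps)
  finally show ?thesis .
qed

section \<open>Mixing gamma laws over a Poisson number of parts\<close>

lemma pmf_integral_sums:
  fixes p :: "nat pmf" and f :: "nat \<Rightarrow> real"
  assumes "\<And>m. \<bar>f m\<bar> \<le> B"
  shows "(\<lambda>m. pmf p m * f m) sums (\<integral>m. f m \<partial>measure_pmf p)"
proof -
  have int: "integrable (measure_pmf p) f"
    by (rule measure_pmf.integrable_const_bound[where B=B]) (use assms in auto)
  have "integrable (count_space UNIV) (\<lambda>m. pmf p m *\<^sub>R f m)"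
    using int by (simp add: measure_pmf_eq_density integrable_density)
  then have "(\<lambda>m. pmf p m *\<^sub>R f m) sums (\<integral>m. pmf p m *\<^sub>R f m \<partial>count_space UNIV)"
    by (rule sums_integral_count_space_nat)
  also have "(\<integral>m. pmf p m *\<^sub>R f m \<partial>count_space UNIV) = (\<integral>m. f m \<partial>measure_pmf p)"
    by (simp add: measure_pmf_eq_density integral_density)
  finally show ?thesis by simp
qed

text \<open>The empty partition has weight 0, so the point mass at 0 serves as the gamma law of
  shape 0; its Laplace transform is 1, in line with the formula for positive shapes.\<close>

definition gamma_kernel :: "nat \<Rightarrow> nat \<Rightarrow> real measure" where
  "gamma_kernel q m = (if m = 0 then return borel 0 else gamma_measure (real m / real q))"

text \<open>This is a compound Poisson law: the law of a sum of a Poisson number of independent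
  gamma variables of shape \<open>1 / q\<close>. Since shapes add up, it can be written as a
  mixture.\<close>

definition compound_measure :: "nat \<Rightarrow> real \<Rightarrow> real measure" where
  "compound_measure q M = measure_pmf (poisson_pmf M) \<bind> gamma_kernel q"

lemma nonneg_distribution_gamma_kernel:
  assumes "1 \<le> q"
  shows "nonneg_distribution (gamma_kernel q m)"
proof (cases "m = 0")
  case True
  then show ?thesis
    by (simp add: gamma_kernel_def nonneg_distribution_def real_distribution_def
        real_distribution_axioms_def prob_space_return measure_return)
next
  case False
  then show ?thesis using assms
    by (simp add: gamma_kernel_def nonneg_distribution_gamma_measure)
qed

text \<open>Written as a power of a base independent of \<open>m\<close>, so that averaging over
  \<open>m\<close> amounts to evaluating the Poisson generating function.\<close>

lemma laplace_gamma_kernel: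
  assumes "1 \<le> q" "0 \<le> s"
  shows "laplace (gamma_kernel q m) s = ((1 + s) powr (- 1 / real q)) ^ m"
proof (cases "m = 0")
  case True
  then show ?thesis by (simp add: gamma_kernel_def laplace_def integral_return)
next
  case False
  have "((1 + s) powr (- 1 / real q)) ^ m = (1 + s) powr (- (real m / real q))"
    using assms by (simp add: powr_realpow [symmetric] powr_powr)
  then show ?thesis using assms False by (simp add: gamma_kernel_def laplace_gamma_measure)
qed

lemma measurable_gamma_kernel:
  assumes "1 \<le> q"
  shows "gamma_kernel q \<in> measurable (measure_pmf p) (subprob_algebra borel)"
proof -
  have "gamma_kernel q m \<in> space (subprob_algebra borel)" for m
  proof -
    interpret real_distribution "gamma_kernel q m"
      using nonneg_distribution_gamma_kernel[OF assms, of m] by (simp add: nonneg_distribution_def)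
    show ?thesis
      by (simp add: space_subprob_algebra prob_space_imp_subprob_space prob_space_axioms)
  qed
  then show ?thesis by (simp add: measurable_measure_pmf)
qed

lemma measure_compound_sums:
  assumes "1 \<le> q" and "B \<in> sets borel"
  shows "(\<lambda>m. pmf (poisson_pmf M) m * measure (gamma_kernel q m) B) sums measure (compound_measure q M) B"
proof -
  have "\<bar>measure (gamma_kernel q m) B\<bar> \<le> 1" for m
  proof -
    interpret real_distribution "gamma_kernel q m"
      using nonneg_distribution_gamma_kernel[OF assms(1), of m] by (simp add: nonneg_distribution_def)
    show ?thesis by simp
  qed
  then show ?thesis
    unfolding compound_measure_def measure_pmf.measure_bind[OF measurable_gamma_kernel[OF assms(1)] assms(2)]
    by (rule pmf_integral_sums)
qed

lemma nonneg_distribution_compound: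
  assumes "1 \<le> q"
  shows "nonneg_distribution (compound_measure q M)"
proof -
  have "prob_space (compound_measure q M)"
    unfolding compound_measure_def
    using nonneg_distribution_gamma_kernel[OF assms]
    by (intro measure_pmf.prob_space_bind[OF _ measurable_gamma_kernel[OF assms]])
       (auto simp: nonneg_distribution_def real_distribution_def)
  moreover have "sets (compound_measure q M) = sets borel"
    unfolding compound_measure_def
    by (rule sets_bind[OF sets_kernel[OF measurable_gamma_kernel[OF assms]]]) auto
  moreover have "measure (compound_measure q M) {..<0} = 0"
    using measure_compound_sums[OF assms, of "{..<0}" M] nonneg_distribution_gamma_kernel[OF assms]
    by (simp add: nonneg_distribution_def sums_unique2[OF _ sums_zero])
  ultimately show ?thesis
    by (simp add: nonneg_distribution_def real_distribution_def real_distribution_axioms_def)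
qed

text \<open>Gamma laws of positive shape have no atoms, so only the term \<open>m = 0\<close>
  charges the origin, with its Poisson probability.\<close>

lemma measure_compound_0:
  assumes "1 \<le> q" "0 < M"
  shows "measure (compound_measure q M) {0} = exp (- M)"
proof -
  have "(\<lambda>m. pmf (poisson_pmf M) m * measure (gamma_kernel q m) {0}) = (\<lambda>m. if m = 0 then exp (- M) else 0)"
    using assms by (auto simp: fun_eq_iff gamma_kernel_def measure_gamma_measure_singleton measure_return)
  moreover have "(\<lambda>m::nat. if m = 0 then exp (- M) else 0) sums exp (- M)"
    using sums_If_finite_set[of "{0::nat}" "\<lambda>_. exp (- M)"] by simp
  ultimately show ?thesis
    using measure_compound_sums[OF assms(1), of "{0}" M] by (simp add: sums_unique2)
qed

lemma cdf_gamma_kernel_0: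
  assumes "1 \<le> q" 
  shows "cdf (gamma_kernel q m) 0 = (if m = 0 then 1 else 0)"
  using assms by (simp add: gamma_kernel_def cdf_gamma_measure_neg) (simp add: cdf_def measure_return)

lemma cdf_compound_0:
  assumes "1 \<le> q" "0 < M"
  shows "cdf (compound_measure q M) 0 = exp (- M)"
proof -
  have "(\<lambda>m. pmf (poisson_pmf M) m * measure (gamma_kernel q m) {..0}) = (\<lambda>m. if m = 0 then exp (- M) else 0)"
    using assms cdf_gamma_kernel_0[OF assms(1)] by (auto simp: fun_eq_iff cdf_def)
  moreover have "(\<lambda>m::nat. if m = 0 then exp (- M) else 0) sums exp (- M)"
    using sums_If_finite_set[of "{0::nat}" "\<lambda>_. exp (- M)"] by simp
  ultimately show ?thesis
    using measure_compound_sums[OF assms(1), of "{..0}" M] by (simp add: sums_unique2 cdf_def)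
qed


lemma laplace_compound:
  assumes q: "1 \<le> q" and "0 < M" "0 \<le> s"
  shows "laplace (compound_measure q M) s = exp (- M * (1 - (1 + s) powr (- 1 / real q)))"
proof -
  let ?p = "poisson_pmf M" and ?c = "(1 + s) powr (- 1 / real q)"
  \<comment> \<open>\<open>integral_bind\<close> wants a bounded integrand, whereas
    \<open>exp (- s * x)\<close> may be unbounded for negative \<open>x\<close>. It is replaced by a
    version bounded by 1 that agrees with it almost everywhere.\<close>
  have trunc: "laplace \<nu> s = (\<integral>x. exp (- s * max 0 x) \<partial>\<nu>)" if "nonneg_distribution \<nu>" for \<nu>
  proof -
    have [measurable_cong]: "sets \<nu> = sets borel"
      using that by (simp add: nonneg_distribution_def real_distribution_def real_distribution_axioms_def)
    have "AE x in \<nu>. exp (- s * x) = exp (- s * max 0 x)"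
      using nonneg_distribution_AE[OF that] by eventually_elim simp
    then show ?thesis unfolding laplace_def by (intro integral_cong_AE) auto
  qed
  have "laplace (compound_measure q M) s = (\<integral>x. exp (- s * max 0 x) \<partial>compound_measure q M)"
    by (rule trunc[OF nonneg_distribution_compound[OF q]])
  also have "\<dots> = (\<integral>m. \<integral>x. exp (- s * max 0 x) \<partial>gamma_kernel q m \<partial>measure_pmf ?p)"
    unfolding compound_measure_def
  proof (rule integral_bind[where B = 1 and B' = 1 and K = borel])
    show "AE m in measure_pmf ?p. emeasure (gamma_kernel q m) (space (gamma_kernel q m)) \<le> ennreal 1"
    proof (rule AE_I2)
      fix m
      interpret real_distribution "gamma_kernel q m"
        using nonneg_distribution_gamma_kernel[OF q, of m] by (simp add: nonneg_distribution_def)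
      show "emeasure (gamma_kernel q m) (space (gamma_kernel q m)) \<le> ennreal 1"
        by (simp only: emeasure_space_1 ennreal_1)
    qed
  qed (use assms measurable_gamma_kernel[OF q] measure_pmf.finite_measure_axioms in auto)
  also have "\<dots> = (\<integral>m. ?c ^ m \<partial>measure_pmf ?p)"
    using trunc[OF nonneg_distribution_gamma_kernel[OF q]] laplace_gamma_kernel[OF q \<open>0 \<le> s\<close>]
    by simp
  also have "\<dots> = exp (- M * (1 - ?c))"
  proof -
    \<comment> \<open>The base is at least 1 and the exponent is not positive, so the powers of
      \<open>?c\<close> stay in [0,1] and form a bounded function of \<open>m\<close>.\<close>
    have "?c \<le> (1 + s) powr 0"
      using assms by (intro powr_mono) auto
    then have "0 \<le> ?c" "?c \<le> 1" using assms by auto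
    then have "\<bar>?c ^ m\<bar> \<le> 1" for m by (simp add: power_le_one)
    then have "(\<lambda>m. pmf ?p m * ?c ^ m) sums (\<integral>m. ?c ^ m \<partial>measure_pmf ?p)"
      by (rule pmf_integral_sums)
    moreover have "(\<lambda>m. pmf ?p m * ?c ^ m) = (\<lambda>m. exp (- M) * ((M * ?c) ^ m /\<^sub>R fact m))"
      using \<open>0 < M\<close> by (auto simp: fun_eq_iff power_mult_distrib field_simps)
    moreover have "(\<lambda>m. exp (- M) * ((M * ?c) ^ m /\<^sub>R fact m)) sums (exp (- M) * exp (M * ?c))"
      by (intro sums_mult exp_converges)
    ultimately have "(\<integral>m. ?c ^ m \<partial>measure_pmf ?p) = exp (- M) * exp (M * ?c)"
      by (simp add: sums_unique2)
    then show ?thesis by (simp add: algebra_simps flip: exp_add)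
  qed
  finally show ?thesis .
qed

text \<open>For a law on the nonnegative reals, conditioning on positivity removes exactly the atom
  at 0: on \<open>x \<ge> 0\<close> the distribution function, and likewise the Laplace transform,
  loses the atom and is rescaled. For the compound law the atom is the contribution of the empty
  partition.\<close>

lemma conditioned_distribution:
  assumes \<mu>: "nonneg_distribution \<mu>" and lt1: "measure \<mu> {0} < 1"
  defines "\<kappa> \<equiv> uniform_measure \<mu> {0<..}"
  shows "nonneg_distribution \<kappa>"
    and "cdf \<kappa> x = (if x < 0 then 0 else (cdf \<mu> x - measure \<mu> {0}) / (1 - measure \<mu> {0}))"
    and "0 \<le> s \<Longrightarrow> laplace \<kappa> s = (laplace \<mu> s - measure \<mu> {0}) / (1 - measure \<mu> {0})"
proof -
  interpret \<mu>: real_distribution \<mu> using \<mu> by (simp add: nonneg_distribution_def)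
  have neg: "measure \<mu> {..<0} = 0" using \<mu> by (simp add: nonneg_distribution_def)
  have split: "measure \<mu> {..x} = measure \<mu> {0} + measure \<mu> {0<..x}" if "0 \<le> x" for x
  proof -
    have "{..x} = {..<0} \<union> ({0} \<union> {0<..x})" using that by auto
    also have "measure \<mu> \<dots> = measure \<mu> {..<0} + measure \<mu> ({0} \<union> {0<..x})"
      by (rule \<mu>.finite_measure_Union) auto
    also have "measure \<mu> ({0} \<union> {0<..x}) = measure \<mu> {0} + measure \<mu> {0<..x}"
      by (rule \<mu>.finite_measure_Union) auto
    finally show ?thesis using neg by simp
  qed
  have pos: "measure \<mu> {0<..} = 1 - measure \<mu> {0}"
  proof -
    have "measure \<mu> {..0} = measure \<mu> {0}" using split[of 0] by simp
    moreover have "UNIV - {..0} = {0::real<..}" by auto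
    ultimately show ?thesis
      using \<mu>.prob_compl[of "{..0}"] by (simp add: \<mu>.space_eq_univ)
  qed
  have em: "emeasure \<mu> {0<..} = ennreal (1 - measure \<mu> {0})"
    by (simp add: \<mu>.emeasure_eq_measure pos)
  then have nz: "emeasure \<mu> {0<..} \<noteq> 0" "emeasure \<mu> {0<..} \<noteq> \<infinity>"
    using lt1 by (auto simp: ennreal_eq_0_iff)
  have mk: "measure \<kappa> B = measure \<mu> ({0<..} \<inter> B) / (1 - measure \<mu> {0})" if "B \<in> sets borel" for B
    unfolding \<kappa>_def using that nz by (subst measure_uniform_measure) (auto simp: pos)
  have "prob_space \<kappa>" unfolding \<kappa>_def using nz by (intro prob_space_uniform_measure)
  moreover have "measure \<kappa> {..<0} = 0"
  proof -
    have "{0<..} \<inter> {..<0::real} = {}" by auto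
    then show ?thesis by (simp add: mk)
  qed
  ultimately show "nonneg_distribution \<kappa>"
    by (simp add: nonneg_distribution_def real_distribution_def real_distribution_axioms_def \<kappa>_def)
  show "cdf \<kappa> x = (if x < 0 then 0 else (cdf \<mu> x - measure \<mu> {0}) / (1 - measure \<mu> {0}))"
  proof -
    have "{0<..} \<inter> {..x} = {0<..x}" by auto
    then show ?thesis using split[of x] by (auto simp: cdf_def mk)
  qed
  show "laplace \<kappa> s = (laplace \<mu> s - measure \<mu> {0}) / (1 - measure \<mu> {0})" if s: "0 \<le> s"
  proof -
    let ?d = "1 - measure \<mu> {0}"
    have dens: "\<kappa> = density \<mu> (\<lambda>x. ennreal (indicator {0<..} x / ?d))"
      unfolding \<kappa>_def uniform_measure_def em
      using lt1 by (intro density_cong) (auto simp: indicator_def divide_ennreal ennreal_1 [symmetric] simp del: ennreal_1)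
    have int: "integrable \<mu> (\<lambda>x. exp (- s * x))"
      by (rule \<mu>.integrable_const_bound[where B = 1])
         (use nonneg_distribution_AE[OF \<mu>] s in \<open>auto\<close>)
    have "laplace \<kappa> s = (\<integral>x. indicator {0<..} x / ?d * exp (- s * x) \<partial>\<mu>)"
      unfolding laplace_def dens using lt1 by (subst integral_real_density) auto
    \<comment> \<open>On \<open>x \<ge> 0\<close> the indicator of the positive half-line is 1 minus
      that of \<open>{0}\<close>, and the exponential equals 1 at 0.\<close>
    also have "\<dots> = (\<integral>x. (exp (- s * x) - indicator {0} x) / ?d \<partial>\<mu>)"
    proof (rule integral_cong_AE)
      show "AE x in \<mu>. indicator {0<..} x / ?d * exp (- s * x) = (exp (- s * x) - indicator {0} x) / ?d"
        using nonneg_distribution_AE[OF \<mu>] by eventually_elim (auto simp: indicator_def)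
    qed auto
    also have "\<dots> = (laplace \<mu> s - measure \<mu> {0}) / ?d"
      using int by (simp add: laplace_def \<mu>.emeasure_eq_measure)
    finally show ?thesis .
  qed
qed

section \<open>Elementary symmetric sums of a weight\<close>

text \<open>Kept abstract in the weight because it is instantiated both at the rate \<open>c\<close>
  and at the tilted rate \<open>c * (1 + s)\<close>.\<close>

locale weighted_subsets =
  fixes B :: "'a set" and a :: "'a \<Rightarrow> real"
  assumes a_nonneg: "\<And>j. j \<in> B \<Longrightarrow> 0 \<le> a j" and a_summable: "a summable_on B"
begin

definition w :: "'a set \<Rightarrow> real" where "w S = (\<Prod>j\<in>S. a j)"

definition total :: real where "total = infsum a B"

definition slice :: "nat \<Rightarrow> 'a set set" where "slice k = {S \<in> Fpow B. card S = k}"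

definition elem :: "nat \<Rightarrow> real" where "elem k = infsum w (slice k)"

lemma w_nonneg: "S \<in> Fpow B \<Longrightarrow> 0 \<le> w S"
  by (auto simp: w_def Fpow_def intro!: prod_nonneg a_nonneg)

lemma total_nonneg: "0 \<le> total"
  unfolding total_def by (intro infsum_nonneg a_nonneg)

lemma infsum_Diff_finite:
  fixes f :: "'a \<Rightarrow> real"
  assumes "f summable_on B" "T \<in> Fpow B"
  shows "infsum f (B - T) = infsum f B - (\<Sum>j\<in>T. f j)"
proof -
  have T: "T \<subseteq> B" "finite T" using assms(2) by (auto simp: Fpow_def)
  show ?thesis
    using infsum_Diff[of f B T] T assms(1) by simp
qed

text \<open>
  Both sides run over the pairs of a set and a marked element: \<open>(S, j)\<close> corresponds to
  \<open>(T, j)\<close> with \<open>T = S - {j}\<close>.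
\<close>

lemma double_count:
  fixes h :: "'a set \<Rightarrow> 'a \<Rightarrow> real"
  assumes h: "\<And>S j. S \<in> Fpow B \<Longrightarrow> j \<in> S \<Longrightarrow> 0 \<le> h S j"
    and inner: "\<And>T. T \<in> Fpow B \<Longrightarrow> ((\<lambda>j. a j * h (insert j T) j) has_sum g T) (B - T)"
    and outer: "((\<lambda>T. w T * g T) has_sum x) (Fpow B)"
  shows "((\<lambda>S. w S * (\<Sum>j\<in>S. h S j)) has_sum x) (Fpow B)"
proof -
  let ?f = "\<lambda>(T, j). w T * (a j * h (insert j T) j)"
  let ?g = "\<lambda>(S, j). w S * h S j"
  have in1: "((\<lambda>j. ?f (T, j)) has_sum (w T * g T)) (B - T)" if "T \<in> Fpow B" for T
    using has_sum_cmult_right[OF inner[OF that]] by simp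
  \<comment> \<open>All terms are nonnegative, so summability of the iterated sums gives summability
    over the pairs, and the order of summation may be changed.\<close>
  have "?f summable_on Sigma (Fpow B) (\<lambda>T. B - T)"
  proof (rule summable_on_SigmaI[OF in1])
    show "(\<lambda>T. w T * g T) summable_on Fpow B" using outer by (rule has_sum_imp_summable)
    fix T j assume "T \<in> Fpow B" "j \<in> B - T"
    then show "0 \<le> ?f (T, j)"
      using w_nonneg[of T] a_nonneg[of j] h[of "insert j T" j] by (auto simp: Fpow_def)
  qed auto
  then have f: "(?f has_sum x) (Sigma (Fpow B) (\<lambda>T. B - T))"
    using in1 outer by (intro has_sum_SigmaI) auto
  have "(?g has_sum x) (Sigma (Fpow B) (\<lambda>S. S)) \<longleftrightarrow> (?f has_sum x) (Sigma (Fpow B) (\<lambda>T. B - T))"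
  proof (rule has_sum_reindex_bij_witness[where i = "\<lambda>(T, j). (insert j T, j)" and j = "\<lambda>(S, j). (S - {j}, j)"])
    fix p assume "p \<in> Sigma (Fpow B) (\<lambda>S. S)"
    then obtain S j where p: "p = (S, j)" "S \<in> Fpow B" "j \<in> S" by auto
    then have "finite S" by (auto simp: Fpow_def)
    then have "w S = a j * w (S - {j})" using p by (simp add: w_def prod.remove)
    then show "?f (case p of (S, j) \<Rightarrow> (S - {j}, j)) = ?g p"
      using p by (auto simp: insert_absorb)
  qed (auto simp: Fpow_def)
  with f have "(?g has_sum x) (Sigma (Fpow B) (\<lambda>S. S))" by blast
  then show ?thesis
  proof (rule has_sum_SigmaD)
    fix S assume "S \<in> Fpow B"
    then have "finite S" by (auto simp: Fpow_def)
    then show "((\<lambda>j. ?g (S, j)) has_sum (w S * (\<Sum>j\<in>S. h S j))) S"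
      by (simp add: sum_distrib_left has_sum_finiteI)
  qed
qed

lemma elem_0: "w summable_on slice 0" "elem 0 = 1"
proof -
  have "slice 0 = {{}}" by (auto simp: slice_def Fpow_def)
  then show "w summable_on slice 0" "elem 0 = 1" by (auto simp: elem_def w_def)
qed

text \<open>Double counting with mark 1 on the sets of size \<open>Suc k\<close>: such a set is
  counted once per element, and a set \<open>T\<close> of size \<open>k\<close> is extended by the
  elements outside it, of total weight \<open>total - (\<Sum>j\<in>T. a j)\<close>. Summability is
  part of the conclusion because the same step propagates it in
  \<open>slice_summable\<close>.\<close>

lemma elem_Suc:
  assumes "w summable_on slice k"
  shows "w summable_on slice (Suc k)"
    and "real (Suc k) * elem (Suc k) = infsum (\<lambda>T. w T * (total - (\<Sum>j\<in>T. a j))) (slice k)"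
    and "(\<lambda>T. w T * (total - (\<Sum>j\<in>T. a j))) summable_on slice k"
proof -
  let ?r = "\<lambda>T. total - (\<Sum>j\<in>T. a j)"
  have r: "0 \<le> ?r T" "?r T \<le> total" if "T \<in> Fpow B" for T
  proof -
    have "0 \<le> infsum a (B - T)" by (intro infsum_nonneg a_nonneg) auto
    then show "0 \<le> ?r T" using that by (simp add: total_def infsum_Diff_finite[OF a_summable])
    show "?r T \<le> total" using that by (auto simp: Fpow_def intro!: sum_nonneg a_nonneg)
  qed
  show summ: "(\<lambda>T. w T * ?r T) summable_on slice k"
  proof (rule summable_on_comparison_test)
    show "(\<lambda>T. w T * total) summable_on slice k"
      using assms by (rule summable_on_cmult_left)
    fix T assume "T \<in> slice k"
    then have "T \<in> Fpow B" by (simp add: slice_def)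
    then show "w T * ?r T \<le> w T * total" "0 \<le> w T * ?r T"
      using r[of T] w_nonneg[of T] by (auto intro: mult_left_mono)
  qed
  define x where "x = infsum (\<lambda>T. w T * ?r T) (slice k)"
  have "((\<lambda>S. w S * (\<Sum>j\<in>S. if card S = Suc k then 1 else 0)) has_sum x) (Fpow B)"
  proof (rule double_count)
    fix T assume T: "T \<in> Fpow B"
    have "(a has_sum ?r T) (B - T)"
      using infsum_Diff_finite[OF a_summable T] summable_on_subset[OF a_summable, of "B - T"]
      by (auto simp: has_sum_iff total_def)
    then have hs: "((\<lambda>j. if card T = k then a j else 0) has_sum (if card T = k then ?r T else 0)) (B - T)"
      by simp
    have eq: "a j * (if card (insert j T) = Suc k then 1 else 0) = (if card T = k then a j else 0)"
      if "j \<in> B - T" for j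
      using T that by (auto simp: Fpow_def)
    show "((\<lambda>j. a j * (if card (insert j T) = Suc k then 1 else 0)) has_sum (if card T = k then ?r T else 0)) (B - T)"
      using hs by (simp only: has_sum_cong[OF eq])
  next
    have "((\<lambda>T. w T * ?r T) has_sum x) (slice k)"
      using summ by (simp add: x_def)
    then show "((\<lambda>T. w T * (if card T = k then ?r T else 0)) has_sum x) (Fpow B)"
      by (rule has_sum_cong_neutral[THEN iffD1, rotated -1]) (auto simp: slice_def)
  qed auto
  then have "((\<lambda>S. real (Suc k) * w S) has_sum x) (slice (Suc k))"
    by (rule has_sum_cong_neutral[THEN iffD1, rotated -1]) (auto simp: slice_def)
  then have "((\<lambda>S. inverse (real (Suc k)) * (real (Suc k) * w S)) has_sum (inverse (real (Suc k)) * x)) (slice (Suc k))"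
    by (rule has_sum_cmult_right)
  then have "(w has_sum (inverse (real (Suc k)) * x)) (slice (Suc k))"
    by (simp add: mult.assoc [symmetric] del: of_nat_Suc)
  then show "w summable_on slice (Suc k)" "real (Suc k) * elem (Suc k) = x"
    by (auto simp: elem_def has_sum_imp_summable infsumI field_simps)
qed

lemma slice_summable: "w summable_on slice k"
  by (induction k) (simp_all add: elem_0 elem_Suc)

lemma elem_nonneg: "0 \<le> elem k"
  unfolding elem_def by (intro infsum_nonneg w_nonneg) (simp add: slice_def)

text \<open>Upper half of the recursion: the constraint that the added element is new is
  dropped.\<close>

lemma elem_Suc_le: "real (Suc k) * elem (Suc k) \<le> total * elem k"
proof -
  have "infsum (\<lambda>T. w T * (total - (\<Sum>j\<in>T. a j))) (slice k) \<le> infsum (\<lambda>T. w T * total) (slice k)"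
  proof (rule infsum_mono)
    fix T assume "T \<in> slice k"
    then have "T \<in> Fpow B" by (simp add: slice_def)
    moreover from this have "0 \<le> (\<Sum>j\<in>T. a j)" by (auto simp: Fpow_def intro!: sum_nonneg a_nonneg)
    ultimately show "w T * (total - (\<Sum>j\<in>T. a j)) \<le> w T * total"
      by (intro mult_left_mono w_nonneg) auto
  qed (intro elem_Suc slice_summable summable_on_cmult_left)+
  then show ?thesis
    unfolding elem_Suc(2)[OF slice_summable] by (simp add: elem_def infsum_cmult_left' infsum_cmult_right' mult.commute)
qed

text \<open>Lower half of the recursion: the \<open>k\<close> elements already present exclude a
  weight of at most \<open>k * b\<close>. In the application \<open>b\<close> is \<open>z2\<close>,
  which tends to 0.\<close>

lemma elem_Suc_ge:
  assumes b: "\<And>j. j \<in> B \<Longrightarrow> a j \<le> b"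
  shows "(total - real k * b) * elem k \<le> real (Suc k) * elem (Suc k)"
proof -
  have "infsum (\<lambda>T. w T * (total - real k * b)) (slice k) \<le> infsum (\<lambda>T. w T * (total - (\<Sum>j\<in>T. a j))) (slice k)"
  proof (rule infsum_mono)
    fix T assume T: "T \<in> slice k"
    then have "(\<Sum>j\<in>T. a j) \<le> real (card T) * b"
      by (intro sum_bounded_above b) (auto simp: slice_def Fpow_def)
    with T show "w T * (total - real k * b) \<le> w T * (total - (\<Sum>j\<in>T. a j))"
      by (intro mult_left_mono w_nonneg) (auto simp: slice_def)
  qed (intro elem_Suc slice_summable summable_on_cmult_left)+
  then show ?thesis
    unfolding elem_Suc(2)[OF slice_summable] by (simp add: elem_def infsum_cmult_left' infsum_cmult_right' mult.commute)
qed

text \<open>The exponential series obtained here gives summability over all finite sets in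
  \<open>w_summable\<close>, and later the dominating series for the limit.\<close>

lemma elem_le: "elem k \<le> total ^ k / fact k"
proof (induction k)
  case 0
  then show ?case by (simp add: elem_0)
next
  case (Suc k)
  have "real (Suc k) * elem (Suc k) \<le> total * (total ^ k / fact k)"
    using elem_Suc_le[of k] mult_left_mono[OF Suc total_nonneg] by linarith
  then show ?case by (simp add: field_simps del: of_nat_Suc)
qed

lemma has_sum_slices:
  fixes f :: "'a set \<Rightarrow> real"
  assumes "f summable_on Fpow B"
  shows "(\<lambda>k. infsum f (slice k)) sums infsum f (Fpow B)"
proof -
  have "((\<lambda>(k, S). f S) has_sum infsum f (Fpow B)) (Sigma UNIV slice) \<longleftrightarrow> (f has_sum infsum f (Fpow B)) (Fpow B)"
    by (rule has_sum_reindex_bij_witness[where i = "\<lambda>S. (card S, S)" and j = snd]) (auto simp: slice_def)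
  then have "((\<lambda>(k, S). f S) has_sum infsum f (Fpow B)) (Sigma UNIV slice)"
    using assms by (simp add: has_sum_infsum)
  then have "((\<lambda>k. infsum f (slice k)) has_sum infsum f (Fpow B)) UNIV"
  proof (rule has_sum_SigmaD)
    show "((\<lambda>S. case (k, S) of (k, S) \<Rightarrow> f S) has_sum infsum f (slice k)) (slice k)" for k
      using summable_on_subset[OF assms, of "slice k"] by (auto simp: slice_def)
  qed
  then show ?thesis by (rule has_sum_imp_sums)
qed

lemma w_summable: "w summable_on Fpow B"
proof -
  have "summable elem"
    by (rule summable_comparison_test'[OF summable_exp[of total]])
       (use elem_le elem_nonneg in \<open>auto simp: field_simps\<close>)
  then have "elem summable_on UNIV"
    using elem_nonneg by (simp add: summable_on_UNIV_nonneg_real_iff)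
  then have "(\<lambda>(k, S). w S) summable_on Sigma UNIV slice"
    by (intro summable_on_SigmaI[where g = elem])
       (auto simp: elem_def slice_summable intro!: w_nonneg, simp add: slice_def)
  then show ?thesis
    by (subst (asm) summable_on_reindex_bij_witness[where i = "\<lambda>S. (card S, S)" and j = snd and T = "Fpow B" and h = w])
       (auto simp: slice_def)
qed

text \<open>As a number this is the product of the factors \<open>1 + a j\<close>; it is kept as a
  sum because every estimate comes from double counting.\<close>

definition norm_const :: real where "norm_const = infsum w (Fpow B)"

lemma norm_const_ge_1: "1 \<le> norm_const"
proof -
  have "infsum w {{}} \<le> infsum w (Fpow B)"
    by (rule infsum_mono2) (use w_summable w_nonneg in \<open>auto simp: empty_in_Fpow\<close>)
  then show ?thesis by (simp add: norm_const_def w_def)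
qed

text \<open>Double counting with mark \<open>f j\<close>. Up to normalisation the sum is the mean of
  an additive statistic, and dropping the correction for elements already present gives the product
  bound. The instances are the length, a single multiplicity, the weight, and the weight carried by
  large parts.\<close>

lemma sum_moment:
  fixes f :: "'a \<Rightarrow> real"
  assumes f: "\<And>j. j \<in> B \<Longrightarrow> 0 \<le> f j" and summ: "(\<lambda>j. a j * f j) summable_on B"
  shows "((\<lambda>S. w S * (\<Sum>j\<in>S. f j)) has_sum
      infsum (\<lambda>T. w T * (infsum (\<lambda>j. a j * f j) B - (\<Sum>j\<in>T. a j * f j))) (Fpow B)) (Fpow B)"
    and "(\<lambda>T. w T * (infsum (\<lambda>j. a j * f j) B - (\<Sum>j\<in>T. a j * f j))) summable_on Fpow B"
    and "infsum (\<lambda>S. w S * (\<Sum>j\<in>S. f j)) (Fpow B) \<le> infsum (\<lambda>j. a j * f j) B * norm_const"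
proof -
  let ?Q = "infsum (\<lambda>j. a j * f j) B"
  let ?r = "\<lambda>T. ?Q - (\<Sum>j\<in>T. a j * f j)"
  have r: "0 \<le> ?r T" "?r T \<le> ?Q" if "T \<in> Fpow B" for T
  proof -
    have "0 \<le> infsum (\<lambda>j. a j * f j) (B - T)" by (intro infsum_nonneg mult_nonneg_nonneg a_nonneg f) auto
    then show "0 \<le> ?r T" using that by (simp add: infsum_Diff_finite[OF summ])
    show "?r T \<le> ?Q" using that by (auto simp: Fpow_def intro!: sum_nonneg mult_nonneg_nonneg a_nonneg f)
  qed
  have le: "w T * ?r T \<le> w T * ?Q" "0 \<le> w T * ?r T" if "T \<in> Fpow B" for T
    using r[OF that] w_nonneg[OF that] by (auto intro: mult_left_mono)
  have Qs: "(\<lambda>T. w T * ?Q) summable_on Fpow B" by (intro summable_on_cmult_left w_summable)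
  show rs: "(\<lambda>T. w T * ?r T) summable_on Fpow B"
    using Qs le by (rule summable_on_comparison_test)
  show hs: "((\<lambda>S. w S * (\<Sum>j\<in>S. f j)) has_sum infsum (\<lambda>T. w T * ?r T) (Fpow B)) (Fpow B)"
  proof (rule double_count)
    fix T assume T: "T \<in> Fpow B"
    have "(\<lambda>j. a j * f j) summable_on (B - T)" by (rule summable_on_subset[OF summ]) auto
    then show "((\<lambda>j. a j * f j) has_sum ?r T) (B - T)"
      using infsum_Diff_finite[OF summ T] by (simp add: has_sum_iff)
  qed (use rs f in \<open>auto simp: Fpow_def\<close>)
  have "infsum (\<lambda>S. w S * (\<Sum>j\<in>S. f j)) (Fpow B) = infsum (\<lambda>T. w T * ?r T) (Fpow B)"
    using hs by (rule infsumI)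
  also have "\<dots> \<le> infsum (\<lambda>T. w T * ?Q) (Fpow B)"
    by (rule infsum_mono[OF rs Qs]) (rule le)
  finally show "infsum (\<lambda>S. w S * (\<Sum>j\<in>S. f j)) (Fpow B) \<le> ?Q * norm_const"
    by (simp add: infsum_cmult_left' norm_const_def mult.commute)
qed

end

section \<open>The power series with exponents in the q-th powers\<close>

text \<open>Times \<open>z2\<close> this is the total weight of the one-part partitions. For
  \<open>q = 2\<close> it is half of Jacobi's theta series after removal of the constant
  term.\<close>

definition power_theta :: "nat \<Rightarrow> real \<Rightarrow> real" where
  "power_theta q g = (\<Sum>\<^sub>\<infinity>l\<in>qpowers q. exp (- g * real l))"

lemma exp_summable_on:
  assumes "0 < g"
  shows "(\<lambda>l. exp (- g * real l)) summable_on A"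
proof -
  have "summable (\<lambda>l. exp (- g) ^ l)" using assms by (intro summable_geometric) simp
  then have "summable (\<lambda>l. exp (- g * real l))"
    by (simp add: exp_of_nat_mult [symmetric] mult.commute)
  then have "(\<lambda>l. exp (- g * real l)) summable_on UNIV"
    by (subst summable_on_UNIV_nonneg_real_iff) auto
  then show ?thesis by (rule summable_on_subset) simp
qed

lemma exp_weight_summable_on:
  assumes "0 < g"
  shows "(\<lambda>l. exp (- g * real l) * real l) summable_on A"
proof -
  \<comment> \<open>Half of the decay rate is spent on the factor \<open>real l\<close>, which is at
    most \<open>2 / g * exp (g / 2 * real l)\<close>.\<close>
  have "(\<lambda>l. (2 / g) * exp (- (g / 2) * real l)) summable_on A"
    using assms by (intro summable_on_cmult_right exp_summable_on) simp
  then show ?thesis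
  proof (rule summable_on_comparison_test)
    fix l
    have "g / 2 * real l \<le> exp (g / 2 * real l)"
      using exp_ge_add_one_self[of "g / 2 * real l"] by linarith
    then have "exp (- g * real l) * (g / 2 * real l) \<le> exp (- g * real l) * exp (g / 2 * real l)"
      by (intro mult_left_mono) auto
    also have "\<dots> = exp (- (g / 2) * real l)" by (simp add: exp_add [symmetric])
    finally show "exp (- g * real l) * real l \<le> (2 / g) * exp (- (g / 2) * real l)"
      using assms by (simp add: field_simps)
  qed auto
qed

lemma power_theta_sums:
  assumes "0 < g" "1 \<le> q"
  shows "(\<lambda>j. exp (- g * real (Suc j) ^ q)) sums power_theta q g"
proof -
  have "((\<lambda>l. exp (- g * real l)) has_sum power_theta q g) (qpowers q)"
    using exp_summable_on[OF assms(1)] by (simp add: power_theta_def)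
  also have "((\<lambda>l. exp (- g * real l)) has_sum power_theta q g) (qpowers q) \<longleftrightarrow>
      ((\<lambda>j. exp (- g * real (Suc j) ^ q)) has_sum power_theta q g) UNIV"
  proof (rule has_sum_reindex_bij_betw[symmetric, THEN trans])
    have "inj (\<lambda>j. Suc j ^ q)"
      using assms(2) by (auto simp: inj_on_def power_eq_iff_eq_base)
    moreover have "range (\<lambda>j. Suc j ^ q) = qpowers q"
      by (auto simp: qpowers_def) (metis Suc_pred' rangeI less_eq_Suc_le One_nat_def)
    ultimately show "bij_betw (\<lambda>j. Suc j ^ q) UNIV (qpowers q)" by (simp add: bij_betw_def)
  qed simp
  finally show ?thesis by (rule has_sum_imp_sums)
qed

lemma power_theta_pos:
  assumes "0 < g" "1 \<le> q"
  shows "0 < power_theta q g"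
  using suminf_pos[OF sums_summable[OF power_theta_sums[OF assms]]] sums_unique[OF power_theta_sums[OF assms]] by simp

text \<open>This is \<open>Gamma (1 + 1 / q)\<close>, the constant in the asymptotics of
  \<open>z2\<close>. It cancels in \<open>power_theta_ratio\<close>, where its positivity is what
  counts.\<close>

definition exp_power_integral :: "nat \<Rightarrow> real" where
  "exp_power_integral q = (\<integral>x. indicator {0..} x * exp (- (x ^ q)) \<partial>lborel)"

lemma integrable_exp_power:
  assumes "1 \<le> q"
  shows "integrable lborel (\<lambda>x::real. indicator {0..} x * exp (- (x ^ q)))"
proof (rule Bochner_Integration.integrable_bound)
  \<comment> \<open>For \<open>x > 0\<close> the dominating function is \<open>exp (1 - x)\<close>,
    by \<open>x - 1 \<le> x ^ q\<close>. At the single point 0 \<open>gamma_density\<close>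
    vanishes, hence the bound almost everywhere.\<close>
  show "integrable lborel (\<lambda>x. exp 1 * gamma_density 1 x)"
    using has_bochner_integral_gamma_density[of 1] by (simp add: has_bochner_integral_iff)
  show "AE x in lborel. norm (indicator {0..} x * exp (- (x ^ q))) \<le> norm (exp 1 * gamma_density 1 (x::real))"
    using AE_lborel_singleton[of 0]
  proof eventually_elim
    case (elim x)
    have "x - 1 \<le> x ^ q" if "x > 0"
    proof (cases "1 \<le> x")
      case True
      then show ?thesis using assms self_le_power[of x q] by simp
    next
      case False
      then show ?thesis using that by (smt (verit) zero_le_power)
    qed
    with elim show ?case
      by (auto simp: indicator_def gamma_density_def exp_add [symmetric])
  qed
qed auto

text \<open>Integral test for the decreasing function \<open>exp (- g * x ^ q)\<close>: the sum from
  \<open>k = 0\<close> exceeds the integral by an amount between 0 and its first term 1. As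
  \<open>power_theta\<close> starts at \<open>k = 1\<close>, it lies between the integral minus 1
  and the integral, which scaling by \<open>g powr (1 / q)\<close> evaluates.\<close>

lemma power_theta_bounds:
  assumes "0 < g" and q: "1 \<le> q"
  shows "power_theta q g \<le> exp_power_integral q * g powr (- 1 / real q)" and "exp_power_integral q * g powr (- 1 / real q) - 1 \<le> power_theta q g"
proof -
  define c where "c = g powr (1 / real q)"
  have "c > 0" using assms by (simp add: c_def)
  have cq: "c ^ q = g" using assms by (simp add: c_def powr_realpow [symmetric] powr_powr)
  let ?f = "\<lambda>x::real. exp (- g * x ^ q)"
  have f_scale: "indicator {0..} x * ?f x = indicator {0..} (0 + c * x) * exp (- ((0 + c * x) ^ q))" for x
    using \<open>c > 0\<close> cq by (auto simp: indicator_def power_mult_distrib zero_le_mult_iff)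
  have int: "integrable lborel (\<lambda>x. indicator {0..} x * ?f x)"
    unfolding f_scale using \<open>c > 0\<close>
    by (intro lborel_integrable_real_affine integrable_exp_power[OF q]) simp
  have "(\<integral>x. indicator {0..} x * ?f x \<partial>lborel) = exp_power_integral q / c"
    unfolding f_scale using \<open>c > 0\<close>
      lborel_integral_real_affine[of c "\<lambda>x. indicator {0..} x * exp (- (x ^ q))" 0]
    by (simp add: exp_power_integral_def)
  then have val: "(\<integral>x. indicator {0..} x * ?f x \<partial>lborel) = exp_power_integral q * g powr (- 1 / real q)"
    by (simp add: c_def powr_minus field_simps)
  interpret antimono_fun_sum_integral_diff ?f
  proof
    show "continuous_on {0..} ?f" by (intro continuous_intros)
  qed (use assms in \<open>auto intro!: power_mono mult_left_mono\<close>)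
  have lim1: "(\<lambda>n. integral {0..real n} ?f) \<longlonglongrightarrow> exp_power_integral q * g powr (- 1 / real q)"
  proof -
    have "(\<lambda>n. \<integral>x. indicator {..real n} x *\<^sub>R (indicator {0..} x * ?f x) \<partial>lborel) \<longlonglongrightarrow> exp_power_integral q * g powr (- 1 / real q)"
      unfolding val [symmetric]
      by (rule filterlim_compose[OF tendsto_integral_at_top[OF _ int] filterlim_real_sequentially]) simp
    moreover have "(\<integral>x. indicator {..real n} x *\<^sub>R (indicator {0..} x * ?f x) \<partial>lborel) = integral {0..real n} ?f" for n
    proof -
      have "(\<integral>x. indicator {..real n} x *\<^sub>R (indicator {0..} x * ?f x) \<partial>lborel) = (LINT x:{0..real n}|lborel. ?f x)"
        unfolding set_lebesgue_integral_def
        by (intro Bochner_Integration.integral_cong) (auto simp: indicator_def)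
      also have "\<dots> = integral {0..real n} ?f"
        by (intro set_borel_integral_eq_integral borel_integrable_atLeastAtMost' continuous_intros)
      finally show ?thesis .
    qed
    ultimately show ?thesis by simp
  qed
  \<comment> \<open>The comparison series starts at \<open>k = 0\<close>, where the term is 1
    because \<open>0 ^ q = 0\<close> for \<open>q \<ge> 1\<close>.\<close>
  have lim2: "(\<lambda>n. \<Sum>k\<le>n. ?f (real k)) \<longlonglongrightarrow> 1 + power_theta q g"
  proof -
    have "(\<lambda>k. ?f (real k)) sums (power_theta q g + ?f (real 0))"
      using power_theta_sums[OF assms] by (subst sums_Suc_iff [symmetric]) simp
    then show ?thesis using q by (simp add: sums_def_le add.commute power_0_left)
  qed
  have lim: "sum_integral_diff_series \<longlonglongrightarrow> 1 + power_theta q g - exp_power_integral q * g powr (- 1 / real q)"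
    unfolding sum_integral_diff_series_def [abs_def] by (intro tendsto_diff lim1 lim2)
  have "0 \<le> 1 + power_theta q g - exp_power_integral q * g powr (- 1 / real q)"
    using sum_integral_diff_series_nonneg by (intro tendsto_lowerbound[OF lim]) auto
  then show "exp_power_integral q * g powr (- 1 / real q) - 1 \<le> power_theta q g" by simp
  have "sum_integral_diff_series 0 = 1"
    unfolding sum_integral_diff_series_def using q by (simp add: power_0_left)
  then have "sum_integral_diff_series n \<le> 1" for n
    using sum_integral_diff_series_antimono[of 0 n] by simp
  then have "1 + power_theta q g - exp_power_integral q * g powr (- 1 / real q) \<le> 1"
    by (intro tendsto_upperbound[OF lim]) auto
  then show "power_theta q g \<le> exp_power_integral q * g powr (- 1 / real q)" by simp
qed

lemma exp_power_integral_pos: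
  assumes "1 \<le> q"
  shows "0 < exp_power_integral q"
  using power_theta_bounds(1)[of 1 q] power_theta_pos[of 1 q] assms by simp

lemma power_theta_asymp:
  assumes q: "1 \<le> q"
  shows "((\<lambda>g. g powr (1 / real q) * power_theta q g) \<longlongrightarrow> exp_power_integral q) (at_right 0)"
proof (rule tendsto_sandwich)
  have pow: "((\<lambda>g::real. g powr (1 / real q)) \<longlongrightarrow> 0) (at_right 0)"
    using q tendsto_powr'[of "\<lambda>g. g" 0 "at_right 0" "\<lambda>_. 1 / real q" "1 / real q"]
    by (auto simp: eventually_at_filter intro!: tendsto_intros)
  show "((\<lambda>g. exp_power_integral q - g powr (1 / real q)) \<longlongrightarrow> exp_power_integral q) (at_right 0)"
    using tendsto_diff[OF tendsto_const pow, of "exp_power_integral q"] by simp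
  have ev: "\<forall>\<^sub>F g::real in at_right 0. 0 < g" by (simp add: eventually_at_filter)
  show "\<forall>\<^sub>F g in at_right 0. exp_power_integral q - g powr (1 / real q) \<le> g powr (1 / real q) * power_theta q g"
    using ev
  proof eventually_elim
    case (elim g)
    have "g powr (1 / real q) * (exp_power_integral q * g powr (- 1 / real q) - 1) \<le> g powr (1 / real q) * power_theta q g"
      using power_theta_bounds(2)[OF elim q] by (intro mult_left_mono) auto
    moreover have "g powr (1 / real q) * g powr (- 1 / real q) = 1"
      using elim by (simp flip: powr_add)
    ultimately show ?case by (simp add: algebra_simps)
  qed
  show "\<forall>\<^sub>F g in at_right 0. g powr (1 / real q) * power_theta q g \<le> exp_power_integral q"
    using ev
  proof eventually_elim
    case (elim g)
    have "g powr (1 / real q) * power_theta q g \<le> g powr (1 / real q) * (exp_power_integral q * g powr (- 1 / real q))"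
      using power_theta_bounds(1)[OF elim q] by (intro mult_left_mono) auto
    with elim show ?case by (simp add: powr_minus field_simps)
  qed
qed simp

text \<open>Regular variation at 0 with index \<open>- 1 / q\<close>; the shape \<open>m / q\<close>
  of the gamma laws originates here.\<close>

lemma power_theta_ratio:
  assumes q: "1 \<le> q" and t: "0 < t"
  shows "((\<lambda>g. power_theta q (t * g) / power_theta q g) \<longlongrightarrow> t powr (- 1 / real q)) (at_right 0)"
proof -
  let ?\<Phi> = "\<lambda>g. g powr (1 / real q) * power_theta q g"
  have "filterlim (\<lambda>g. t * g) (at_right 0) (at_right 0)"
    using t by (intro filterlim_at_withinI tendsto_eq_intros) (auto simp: eventually_at_filter)
  then have "((\<lambda>g. ?\<Phi> (t * g)) \<longlongrightarrow> exp_power_integral q) (at_right 0)"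
    by (rule filterlim_compose[OF power_theta_asymp[OF q]])
  then have "((\<lambda>g. t powr (- 1 / real q) * (?\<Phi> (t * g) / ?\<Phi> g)) \<longlongrightarrow> t powr (- 1 / real q) * (exp_power_integral q / exp_power_integral q)) (at_right 0)"
    using exp_power_integral_pos[OF q] by (intro tendsto_intros power_theta_asymp[OF q]) auto
  moreover have "\<forall>\<^sub>F g::real in at_right 0. 0 < g" by (simp add: eventually_at_filter)
  then have "\<forall>\<^sub>F g in at_right 0. t powr (- 1 / real q) * (?\<Phi> (t * g) / ?\<Phi> g) = power_theta q (t * g) / power_theta q g"
  proof eventually_elim
    case (elim g)
    with t show ?case by (simp add: powr_mult powr_minus field_simps)
  qed
  ultimately show ?thesis
    using exp_power_integral_pos[OF q] by (simp add: tendsto_cong)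
qed

section \<open>Weighted sets of q-th powers\<close>

lemma has_sum_diff_ab_group:
  fixes f g :: "'b \<Rightarrow> 'c :: topological_ab_group_add"
  assumes "(f has_sum x) A" "(g has_sum y) A"
  shows "((\<lambda>i. f i - g i) has_sum (x - y)) A"
  using has_sum_add[OF assms(1), of "\<lambda>i. - g i" "- y"] assms(2) by (simp add: has_sum_uminus)

lemma has_sum_finite_sum:
  fixes f :: "'d \<Rightarrow> 'b \<Rightarrow> 'c :: topological_comm_monoid_add"
  assumes "finite D" "\<And>d. d \<in> D \<Longrightarrow> (f d has_sum x d) A"
  shows "((\<lambda>i. \<Sum>d\<in>D. f d i) has_sum (\<Sum>d\<in>D. x d)) A"
  using assms by (induction D rule: finite_induct) (auto intro: has_sum_add)

lemma has_bochner_integral_point_measure: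
  fixes v h :: "'b \<Rightarrow> real"
  assumes v: "\<And>x. x \<in> C \<Longrightarrow> 0 \<le> v x" and h: "\<And>x. x \<in> C \<Longrightarrow> 0 \<le> h x"
    and summ: "(\<lambda>x. v x * h x) summable_on C"
  shows "has_bochner_integral (point_measure C (\<lambda>x. ennreal (v x))) h (infsum (\<lambda>x. v x * h x) C)"
proof -
  have abs: "Infinite_Set_Sum.abs_summable_on (\<lambda>x. v x * h x) C"
    using summ v h by (subst abs_summable_equivalent [symmetric]) (simp cong: summable_on_cong)
  have "(\<integral>\<^sup>+x. ennreal (h x) \<partial>point_measure C (\<lambda>x. ennreal (v x)))
      = (\<integral>\<^sup>+x. ennreal (v x * h x) \<partial>count_space C)"
    unfolding point_measure_def using v h
    by (subst nn_integral_density) (auto intro!: nn_integral_cong simp: ennreal_mult)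
  also have "\<dots> = ennreal (infsetsum (\<lambda>x. v x * h x) C)"
    using abs v h by (intro nn_integral_conv_infsetsum) auto
  also have "infsetsum (\<lambda>x. v x * h x) C = infsum (\<lambda>x. v x * h x) C"
    by (rule infsetsum_infsum[OF abs])
  finally show ?thesis
    using h v by (intro has_bochner_integral_nn_integral)
      (auto simp: AE_point_measure intro!: infsum_nonneg)
qed

lemma finite_point_measure:
  fixes v :: "'b \<Rightarrow> real"
  assumes v: "\<And>x. x \<in> C \<Longrightarrow> 0 \<le> v x" and summ: "v summable_on C"
  shows "finite_measure (point_measure C (\<lambda>x. ennreal (v x)))"
proof -
  have "has_bochner_integral (point_measure C (\<lambda>x. ennreal (v x))) (\<lambda>_. 1::real) (infsum (\<lambda>x. v x * 1) C)"
    using v summ by (intro has_bochner_integral_point_measure) auto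
  then show ?thesis
    by (intro finite_measureI) (auto simp: has_bochner_integral_iff integrable_iff_bounded)
qed

lemma measure_point_measure:
  fixes v :: "'b \<Rightarrow> real"
  assumes v: "\<And>x. x \<in> C \<Longrightarrow> 0 \<le> v x" and summ: "v summable_on C"
  shows "measure (point_measure C (\<lambda>x. ennreal (v x))) {x \<in> C. P x} = infsum v {x \<in> C. P x}"
proof -
  let ?M = "point_measure C (\<lambda>x. ennreal (v x))"
  have "infsum (\<lambda>x. v x * indicator {x \<in> C. P x} x) C = infsum v {x \<in> C. P x}"
    by (rule infsum_cong_neutral) auto
  moreover have "(\<lambda>x. v x * indicator {x \<in> C. P x} x) summable_on C"
    using summ by (rule summable_on_comparison_test) (auto simp: v indicator_def)
  ultimately have "has_bochner_integral ?M (indicator {x \<in> C. P x}) (infsum v {x \<in> C. P x})"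
    using has_bochner_integral_point_measure[of C v "indicator {x \<in> C. P x}"] v by simp
  moreover have "{x \<in> C. P x} \<inter> space ?M = {x \<in> C. P x}" by (auto simp: space_point_measure)
  ultimately show ?thesis by (simp add: has_bochner_integral_iff)
qed

lemma summable_on_diff_ab_group:
  fixes f g :: "'b \<Rightarrow> 'c :: topological_ab_group_add"
  assumes "f summable_on A" "g summable_on A"
  shows "(\<lambda>i. f i - g i) summable_on A"
  using assms has_sum_diff_ab_group unfolding summable_on_def by blast

lemma summable_on_finite_sum:
  fixes f :: "'d \<Rightarrow> 'b \<Rightarrow> 'c :: topological_comm_monoid_add"
  assumes "finite D" "\<And>d. d \<in> D \<Longrightarrow> f d summable_on A"
  shows "(\<lambda>i. \<Sum>d\<in>D. f d i) summable_on A"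
  using assms by (induction D rule: finite_induct) (auto intro: summable_on_add)

section \<open>Weights of sets of parts in exponential form\<close>

definition part_weight :: "real \<Rightarrow> real \<Rightarrow> nat \<Rightarrow> real" where
  "part_weight z c l = z * exp (- c * real l)"

text \<open>A closed form in the cardinality and the sum of \<open>S\<close>, with a rate in place
  of \<open>z1\<close>: a Laplace factor in the weight then merely shifts the rate, see
  \<open>set_weight_mult\<close>.\<close>

definition set_weight :: "real \<Rightarrow> real \<Rightarrow> nat set \<Rightarrow> real" where
  "set_weight z c S = z ^ card S * exp (- c * real (\<Sum>S))"

abbreviation fsets :: "nat \<Rightarrow> nat set set" where "fsets q \<equiv> Fpow (qpowers q)"

abbreviation fsets_card :: "nat \<Rightarrow> nat \<Rightarrow> nat set set" where
  "fsets_card q m \<equiv> {S \<in> fsets q. card S = m}"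

definition weight_sum :: "nat \<Rightarrow> real \<Rightarrow> real \<Rightarrow> real" where "weight_sum q z c = infsum (set_weight z c) (fsets q)"

definition slice_sum :: "nat \<Rightarrow> real \<Rightarrow> real \<Rightarrow> nat \<Rightarrow> real" where
  "slice_sum q z c m = infsum (set_weight z c) (fsets_card q m)"

lemma set_weight_mult: "set_weight z c S * exp (- d * real (\<Sum>S)) = set_weight z (c + d) S"
  by (simp add: set_weight_def exp_add [symmetric] algebra_simps)

lemma set_weight_nonneg: "0 < z \<Longrightarrow> 0 \<le> set_weight z c S"
  by (simp add: set_weight_def)

lemma weighted_subsets_bw: "0 < z \<Longrightarrow> 0 < c \<Longrightarrow> weighted_subsets (qpowers q) (part_weight z c)"
  unfolding weighted_subsets_def part_weight_def
  using exp_summable_on[of c] by (auto intro!: summable_on_cmult_right)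

locale partition_weights =
  fixes q :: nat and z c :: real
  assumes q: "1 \<le> q" and z: "0 < z" and c: "0 < c"
begin

sublocale weighted_subsets "qpowers q" "part_weight z c"
  using z c by (rule weighted_subsets_bw)

lemma set_weight_eq: "w = set_weight z c"
proof
  fix S :: "nat set"
  show "w S = set_weight z c S"
  proof (cases "finite S")
    case True
    then show ?thesis
      by (simp add: w_def part_weight_def set_weight_def prod.distrib exp_sum [symmetric] sum_distrib_left sum_negf)
  next
    \<comment> \<open>For infinite \<open>S\<close> the product, the cardinality and the sum take
      their default values 1, 0 and 0, so both sides are 1.\<close>
    case False
    then show ?thesis by (simp add: w_def set_weight_def)
  qed
qed

lemma slice_eq: "slice m = fsets_card q m"
  by (simp add: slice_def)

lemma elem_eq: "elem m = slice_sum q z c m"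
  by (simp add: elem_def slice_sum_def set_weight_eq slice_eq)

lemma norm_const_eq: "norm_const = weight_sum q z c"
  by (simp add: norm_const_def weight_sum_def set_weight_eq)

lemma total_eq: "total = z * power_theta q c"
  unfolding total_def power_theta_def unfolding part_weight_def[abs_def] by (rule infsum_cmult_right')

lemma set_weight_summable: "A \<subseteq> fsets q \<Longrightarrow> set_weight z c summable_on A"
  using w_summable by (simp add: set_weight_eq) (rule summable_on_subset)

lemma weight_sum_pos: "0 < weight_sum q z c"
  using norm_const_ge_1 by (simp add: norm_const_eq)

lemma part_weight_le: "part_weight z c l \<le> z"
  using z c by (simp add: part_weight_def mult_left_le)

lemma part_weight_pos: "0 < part_weight z c l"
  using z by (simp add: part_weight_def)

text \<open>The unnormalised probability that \<open>l\<close> is a part.\<close>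

definition occ :: "nat \<Rightarrow> real" where "occ l = infsum (\<lambda>S. set_weight z c S * (if l \<in> S then 1 else 0)) (fsets q)"

text \<open>Marking only the occurrences of \<open>l\<close> gives the equation
  \<open>occ l = a * (weight_sum q z c - occ l)\<close> with \<open>a = part_weight z c l\<close>;
  solving it yields the Fermi-Dirac occupation number.\<close>

lemma
  assumes l: "l \<in> qpowers q"
  shows occ_eq: "occ l = part_weight z c l / (1 + part_weight z c l) * weight_sum q z c"
    and occ_summable: "(\<lambda>S. set_weight z c S * (if l \<in> S then 1 else 0)) summable_on fsets q"
proof -
  let ?f = "\<lambda>j::nat. if j = l then 1 else 0 :: real"
  show summ: "(\<lambda>S. set_weight z c S * (if l \<in> S then 1 else 0)) summable_on fsets q"
    by (rule summable_on_comparison_test[OF set_weight_summable[OF order_refl]]) (use set_weight_nonneg[OF z] in auto)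
  have hs: "((\<lambda>j. part_weight z c j * ?f j) has_sum part_weight z c l) (qpowers q)"
  proof -
    have "((\<lambda>j. part_weight z c j * ?f j) has_sum part_weight z c l) {l}"
      by (rule has_sum_finiteI) auto
    then show ?thesis
      by (rule has_sum_cong_neutral[THEN iffD1, rotated -1]) (use l in auto)
  qed
  have fin: "(\<Sum>j\<in>S. ?f j) = (if l \<in> S then 1 else 0)" "(\<Sum>j\<in>S. part_weight z c j * ?f j) = part_weight z c l * (if l \<in> S then 1 else 0)"
    if "S \<in> fsets q" for S
    using that by (auto simp: Fpow_def if_distrib[of "\<lambda>x. _ * x"] cong: if_cong)
  have "occ l = infsum (\<lambda>S. set_weight z c S * (\<Sum>j\<in>S. ?f j)) (fsets q)"
    unfolding occ_def by (intro infsum_cong) (simp add: fin)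
  also have "\<dots> = infsum (\<lambda>T. set_weight z c T * (part_weight z c l - (\<Sum>j\<in>T. part_weight z c j * ?f j))) (fsets q)"
    using sum_moment(1)[of ?f] hs by (intro infsumI) (simp add: set_weight_eq has_sum_iff)
  also have "\<dots> = infsum (\<lambda>T. part_weight z c l * set_weight z c T - part_weight z c l * (set_weight z c T * (if l \<in> T then 1 else 0))) (fsets q)"
    by (intro infsum_cong) (simp add: fin algebra_simps)
  also have "\<dots> = part_weight z c l * weight_sum q z c - part_weight z c l * occ l"
    unfolding weight_sum_def occ_def
    by (intro infsumI has_sum_diff_ab_group has_sum_cmult_right has_sum_infsum set_weight_summable summ order_refl)
  finally show "occ l = part_weight z c l / (1 + part_weight z c l) * weight_sum q z c"
    using part_weight_pos[of l] by (simp add: field_simps)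
qed

text \<open>Double counting with mark 1. Each part of \<open>T\<close> weighs at most
  \<open>z\<close>, so the correction for parts already present costs at most \<open>z\<close> times
  the unnormalised mean length; moving that term to the other side produces the factor
  \<open>1 + z\<close>.\<close>

lemma mean_length:
  shows "(\<lambda>S. set_weight z c S * real (card S)) summable_on fsets q"
    and "infsum (\<lambda>S. set_weight z c S * real (card S)) (fsets q) \<le> z * power_theta q c * weight_sum q z c"
    and "z * power_theta q c * weight_sum q z c \<le> (1 + z) * infsum (\<lambda>S. set_weight z c S * real (card S)) (fsets q)"
proof -
  let ?L = "infsum (\<lambda>S. set_weight z c S * real (card S)) (fsets q)"
  have one: "(\<lambda>j. part_weight z c j * 1) summable_on qpowers q" using a_summable by simp
  note mom = sum_moment[OF _ one, unfolded set_weight_eq, simplified]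
  show summ: "(\<lambda>S. set_weight z c S * real (card S)) summable_on fsets q"
    using mom(1) by (rule has_sum_imp_summable)
  show "?L \<le> z * power_theta q c * weight_sum q z c"
    using mom(3) by (simp add: total_eq [symmetric] total_def norm_const_eq)
  have "infsum (\<lambda>T. total * set_weight z c T - z * (set_weight z c T * real (card T))) (fsets q)
      \<le> infsum (\<lambda>T. set_weight z c T * (total - (\<Sum>j\<in>T. part_weight z c j))) (fsets q)"
  proof (rule infsum_mono)
    show "(\<lambda>T. total * set_weight z c T - z * (set_weight z c T * real (card T))) summable_on fsets q"
      by (intro summable_on_diff_ab_group summable_on_cmult_right set_weight_summable summ order_refl)
    show "(\<lambda>T. set_weight z c T * (total - (\<Sum>j\<in>T. part_weight z c j))) summable_on fsets q"
      using mom(2) by (simp add: total_def)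
    fix T assume "T \<in> fsets q"
    have "(\<Sum>j\<in>T. part_weight z c j) \<le> real (card T) * z"
      by (rule sum_bounded_above) (rule part_weight_le)
    then have "set_weight z c T * (total - real (card T) * z) \<le> set_weight z c T * (total - (\<Sum>j\<in>T. part_weight z c j))"
      by (intro mult_left_mono set_weight_nonneg z) simp
    then show "total * set_weight z c T - z * (set_weight z c T * real (card T)) \<le> set_weight z c T * (total - (\<Sum>j\<in>T. part_weight z c j))"
      by (simp add: algebra_simps)
  qed
  also have "infsum (\<lambda>T. total * set_weight z c T - z * (set_weight z c T * real (card T))) (fsets q) = total * weight_sum q z c - z * ?L"
    unfolding weight_sum_def
    by (intro infsumI has_sum_diff_ab_group has_sum_cmult_right has_sum_infsum set_weight_summable summ order_refl)
  also have "infsum (\<lambda>T. set_weight z c T * (total - (\<Sum>j\<in>T. part_weight z c j))) (fsets q) = ?L"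
    using mom(1) by (intro infsumI[symmetric]) (simp add: total_def)
  finally show "z * power_theta q c * weight_sum q z c \<le> (1 + z) * ?L"
    by (simp add: total_eq algebra_simps)
qed

text \<open>By linearity the left-hand side is the unnormalised mean number of parts that lie in
  \<open>D\<close>.\<close>

lemma occupation_le_mean_length:
  assumes "finite D" "D \<subseteq> qpowers q"
  shows "(\<Sum>l\<in>D. part_weight z c l / (1 + part_weight z c l)) * weight_sum q z c \<le> infsum (\<lambda>S. set_weight z c S * real (card S)) (fsets q)"
proof -
  have "(\<Sum>l\<in>D. part_weight z c l / (1 + part_weight z c l)) * weight_sum q z c = (\<Sum>l\<in>D. occ l)"
    unfolding sum_distrib_right using assms by (intro sum.cong refl) (auto simp: occ_eq)
  also have "\<dots> = infsum (\<lambda>S. \<Sum>l\<in>D. set_weight z c S * (if l \<in> S then 1 else 0)) (fsets q)"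
    unfolding occ_def using assms occ_summable
    by (intro infsumI[symmetric] has_sum_finite_sum has_sum_infsum) auto
  also have "\<dots> \<le> infsum (\<lambda>S. set_weight z c S * real (card S)) (fsets q)"
  proof (rule infsum_mono)
    show "(\<lambda>S. \<Sum>l\<in>D. set_weight z c S * (if l \<in> S then 1 else 0)) summable_on fsets q"
      using assms occ_summable
      by (intro summable_on_finite_sum) auto
    show "(\<lambda>S. set_weight z c S * real (card S)) summable_on fsets q" by (rule mean_length)
    fix S assume "S \<in> fsets q"
    then have "finite S" by (auto simp: Fpow_def)
    have "(\<Sum>l\<in>D. if l \<in> S then 1 else 0 :: real) = real (card (D \<inter> S))"
      using assms(1) by (simp add: sum.If_cases)
    also have "\<dots> \<le> real (card S)" using \<open>finite S\<close> by (simp add: card_mono)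
    finally show "(\<Sum>l\<in>D. set_weight z c S * (if l \<in> S then 1 else 0)) \<le> set_weight z c S * real (card S)"
      unfolding sum_distrib_left [symmetric] by (intro mult_left_mono set_weight_nonneg z)
  qed
  finally show ?thesis .
qed

text \<open>For parts up to \<open>L\<close> the weight \<open>z * exp (- c * l)\<close> is out of
  control when \<open>z\<close> is large, so the first-moment bound is applied beyond
  \<open>L\<close> only. Being distinct, the parts up to \<open>L\<close> add up to at most
  \<open>\<Sum>{..L}\<close>, whatever their weights.\<close>

lemma mean_weight:
  shows "(\<lambda>S. set_weight z c S * real (\<Sum>S)) summable_on fsets q"
    and "infsum (\<lambda>S. set_weight z c S * real (\<Sum>S)) (fsets q)
      \<le> (real (\<Sum>{..L}) + infsum (\<lambda>l. part_weight z c l * (if l \<le> L then 0 else real l)) (qpowers q)) * weight_sum q z c"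
proof -
  have base: "(\<lambda>l. part_weight z c l * real l) summable_on qpowers q"
    unfolding part_weight_def mult.assoc using c by (intro summable_on_cmult_right exp_weight_summable_on)
  note mom = sum_moment[OF _ base, unfolded set_weight_eq, simplified]
  have eq: "(\<lambda>S. set_weight z c S * real (\<Sum>S)) = (\<lambda>S. set_weight z c S * (\<Sum>j\<in>S. real j))" by simp
  show summ: "(\<lambda>S. set_weight z c S * real (\<Sum>S)) summable_on fsets q"
    unfolding eq using mom(1) by (rule has_sum_imp_summable)
  let ?f = "\<lambda>l. if l \<le> L then 0 else real l"
  have tail: "(\<lambda>l. part_weight z c l * ?f l) summable_on qpowers q"
    by (rule summable_on_comparison_test[OF base]) (use part_weight_pos in \<open>auto simp: less_imp_le\<close>)
  have f0: "0 \<le> ?f j" for j by simp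
  note mom' = sum_moment[OF f0 tail, unfolded set_weight_eq]
  have summ': "(\<lambda>S. set_weight z c S * (\<Sum>l\<in>S. ?f l)) summable_on fsets q"
    using mom'(1) by (rule has_sum_imp_summable)
  have "infsum (\<lambda>S. set_weight z c S * real (\<Sum>S)) (fsets q)
      \<le> infsum (\<lambda>S. real (\<Sum>{..L}) * set_weight z c S + set_weight z c S * (\<Sum>l\<in>S. ?f l)) (fsets q)"
  proof (rule infsum_mono[OF summ])
    show "(\<lambda>S. real (\<Sum>{..L}) * set_weight z c S + set_weight z c S * (\<Sum>l\<in>S. ?f l)) summable_on fsets q"
      by (intro summable_on_add summable_on_cmult_right set_weight_summable summ' order_refl)
    fix S assume "S \<in> fsets q"
    then have S: "finite S" by (auto simp: Fpow_def)
    have "real (\<Sum>S) = (\<Sum>l\<in>S. (if l \<le> L then real l else 0) + ?f l)"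
      by (auto intro!: sum.cong)
    also have "\<dots> = (\<Sum>l\<in>S. if l \<le> L then real l else 0) + (\<Sum>l\<in>S. ?f l)"
      by (rule sum.distrib)
    also have "(\<Sum>l\<in>S. if l \<le> L then real l else 0) = (\<Sum>l\<in>S \<inter> {..L}. real l)"
      using S by (simp add: sum.If_cases atMost_def)
    also have "\<dots> \<le> (\<Sum>l\<in>{..L}. real l)" by (rule sum_mono2) auto
    finally have "set_weight z c S * real (\<Sum>S) \<le> set_weight z c S * (real (\<Sum>{..L}) + (\<Sum>l\<in>S. ?f l))"
      by (intro mult_left_mono set_weight_nonneg z) simp
    then show "set_weight z c S * real (\<Sum>S) \<le> real (\<Sum>{..L}) * set_weight z c S + set_weight z c S * (\<Sum>l\<in>S. ?f l)"
      by (simp add: algebra_simps)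
  qed
  also have "\<dots> = real (\<Sum>{..L}) * weight_sum q z c + infsum (\<lambda>S. set_weight z c S * (\<Sum>l\<in>S. ?f l)) (fsets q)"
    unfolding weight_sum_def
    by (subst infsum_add) (auto intro!: summable_on_cmult_right set_weight_summable summ' simp: infsum_cmult_right')
  also have "\<dots> \<le> real (\<Sum>{..L}) * weight_sum q z c + infsum (\<lambda>l. part_weight z c l * ?f l) (qpowers q) * weight_sum q z c"
    using mom'(3) by (simp add: norm_const_eq)
  finally show "infsum (\<lambda>S. set_weight z c S * real (\<Sum>S)) (fsets q)
      \<le> (real (\<Sum>{..L}) + infsum (\<lambda>l. part_weight z c l * ?f l) (qpowers q)) * weight_sum q z c"
    by (simp add: algebra_simps)
qed

end

section \<open>Calibration\<close>

lemma bij_betw_strict_partitions: "bij_betw set (strict_partitions q) (fsets q)"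
proof (rule bij_betw_imageI)
  show "inj_on set (strict_partitions q)"
  proof
    fix p r assume "p \<in> strict_partitions q" "r \<in> strict_partitions q" and eq: "set p = set r"
    then have "sorted_wrt (<) (rev p)" "sorted_wrt (<) (rev r)"
      by (auto simp: strict_partitions_def sorted_wrt_rev)
    then have "rev p = rev r"
      using strict_sorted_equal[of "rev r" "rev p"] eq by simp
    then show "p = r" by simp
  qed
  show "set ` strict_partitions q = fsets q"
  proof
    show "set ` strict_partitions q \<subseteq> fsets q"
      by (auto simp: strict_partitions_def Fpow_def)
    show "fsets q \<subseteq> set ` strict_partitions q"
    proof
      fix S assume S: "S \<in> fsets q"
      let ?p = "rev (sorted_list_of_set S)"
      have "?p \<in> strict_partitions q" "set ?p = S"
        using S by (auto simp: strict_partitions_def sorted_wrt_rev Fpow_def)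
      then show "S \<in> set ` strict_partitions q" by blast
    qed
  qed
qed

lemma strict_partition_stats:
  assumes "p \<in> strict_partitions q"
  shows "length p = card (set p)" "weight p = \<Sum>(set p)"
proof -
  have "sorted_wrt (<) (rev p)" using assms by (simp add: strict_partitions_def sorted_wrt_rev)
  then have "distinct p" by (simp add: strict_sorted_iff)
  then show "length p = card (set p)" "weight p = \<Sum>(set p)"
    by (simp_all add: distinct_card weight_def sum_list_distinct_conv_sum_set[of p "\<lambda>x. x", simplified])
qed

lemma infsum_strict_partitions:
  "infsum (\<lambda>p. h (set p)) {p \<in> strict_partitions q. P (set p)} = infsum h {S \<in> fsets q. P S}"
proof -
  have "bij_betw set {p \<in> strict_partitions q. P (set p)} {S \<in> fsets q. P S}"
  proof (rule bij_betw_imageI)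
    show "inj_on set {p \<in> strict_partitions q. P (set p)}"
      by (rule inj_on_subset[OF bij_betw_imp_inj_on[OF bij_betw_strict_partitions]]) auto
    show "set ` {p \<in> strict_partitions q. P (set p)} = {S \<in> fsets q. P S}"
      unfolding bij_betw_imp_surj_on[OF bij_betw_strict_partitions, symmetric] by auto
  qed
  then show ?thesis by (rule infsum_reindex_bij_betw)
qed

locale boltzmann_weights =
  fixes q :: nat and z1 z2 :: real
  assumes q1: "1 \<le> q" and z1: "0 < z1" "z1 < 1" and z2: "0 < z2"
begin

definition g :: real where "g = - ln z1"

lemma g_pos: "0 < g" using z1 by (simp add: g_def)

sublocale partition_weights q z2 g
  using q1 z2 g_pos by unfold_locales

lemma set_weight_partition:
  assumes "p \<in> strict_partitions q"
  shows "z1 ^ weight p * z2 ^ length p = set_weight z2 g (set p)"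
proof -
  have "z1 ^ weight p = exp (ln z1) ^ weight p" using z1 by simp
  also have "\<dots> = exp (- g * real (weight p))" by (simp add: g_def exp_of_nat_mult [symmetric] mult.commute)
  finally show ?thesis using strict_partition_stats[OF assms] by (simp add: set_weight_def)
qed

lemma partition_fun_eq: "partition_fun q z1 z2 = weight_sum q z2 g"
proof -
  have "partition_fun q z1 z2 = infsum (\<lambda>p. set_weight z2 g (set p)) {p \<in> strict_partitions q. True}"
    unfolding partition_fun_def by (intro infsum_cong_neutral) (auto simp: set_weight_partition)
  also have "\<dots> = weight_sum q z2 g" by (subst infsum_strict_partitions) (simp add: weight_sum_def)
  finally show ?thesis .
qed

lemma boltzmann_eq: "boltzmann q z1 z2 =
    point_measure (strict_partitions q) (\<lambda>p. ennreal (set_weight z2 g (set p) / weight_sum q z2 g))"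
  unfolding boltzmann_def point_measure_def partition_fun_eq
  by (rule density_cong) (auto simp: set_weight_partition)

lemma space_boltzmann: "space (boltzmann q z1 z2) = strict_partitions q"
  by (simp add: boltzmann_def space_point_measure)

lemma summable_strict_partitions:
  assumes "h summable_on fsets q"
  shows "(\<lambda>p. h (set p)) summable_on strict_partitions q"
  using assms summable_on_reindex_bij_betw[OF bij_betw_strict_partitions[of q]] by blast

lemma boltzmann_integral:
  fixes h :: "nat set \<Rightarrow> real"
  assumes h: "\<And>S. S \<in> fsets q \<Longrightarrow> 0 \<le> h S" and summ: "(\<lambda>S. set_weight z2 g S * h S) summable_on fsets q"
  shows "(\<integral>p. h (set p) \<partial>boltzmann q z1 z2) = infsum (\<lambda>S. set_weight z2 g S * h S) (fsets q) / weight_sum q z2 g"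
proof -
  have "set p \<in> fsets q" if "p \<in> strict_partitions q" for p
    using that by (auto simp: strict_partitions_def Fpow_def)
  then have "has_bochner_integral (boltzmann q z1 z2) (\<lambda>p. h (set p))
      (infsum (\<lambda>p. set_weight z2 g (set p) / weight_sum q z2 g * h (set p)) (strict_partitions q))"
    unfolding boltzmann_eq
    using summable_on_cmult_right[OF summable_strict_partitions[OF summ], of "1 / weight_sum q z2 g"] weight_sum_pos set_weight_nonneg[OF z2] h
    by (intro has_bochner_integral_point_measure) auto
  moreover have "infsum (\<lambda>p. set_weight z2 g (set p) / weight_sum q z2 g * h (set p)) (strict_partitions q)
      = infsum (\<lambda>S. set_weight z2 g S / weight_sum q z2 g * h S) (fsets q)"
    using infsum_strict_partitions[of "\<lambda>S. set_weight z2 g S / weight_sum q z2 g * h S" q "\<lambda>_. True"] by simp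
  moreover have "\<dots> = infsum (\<lambda>S. 1 / weight_sum q z2 g * (set_weight z2 g S * h S)) (fsets q)"
    by (intro infsum_cong) simp
  moreover have "\<dots> = infsum (\<lambda>S. set_weight z2 g S * h S) (fsets q) / weight_sum q z2 g"
    by (subst infsum_cmult_right') simp
  ultimately show ?thesis by (simp add: has_bochner_integral_iff)
qed

lemma boltzmann_prob:
  assumes "\<And>p. p \<in> strict_partitions q \<Longrightarrow> Q p \<longleftrightarrow> P (set p)"
  shows "measure (boltzmann q z1 z2) {p \<in> space (boltzmann q z1 z2). Q p} = infsum (set_weight z2 g) {S \<in> fsets q. P S} / weight_sum q z2 g"
proof -
  have "{p \<in> space (boltzmann q z1 z2). Q p} = {p \<in> strict_partitions q. P (set p)}"
    using assms by (auto simp: space_boltzmann)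
  then have "measure (boltzmann q z1 z2) {p \<in> space (boltzmann q z1 z2). Q p}
      = infsum (\<lambda>p. set_weight z2 g (set p) / weight_sum q z2 g) {p \<in> strict_partitions q. P (set p)}"
    using summable_on_cmult_right[OF summable_strict_partitions[OF set_weight_summable[OF order_refl]], of "1 / weight_sum q z2 g"]
      weight_sum_pos set_weight_nonneg[OF z2]
    by (simp add: boltzmann_eq measure_point_measure)
  also have "\<dots> = infsum (\<lambda>S. set_weight z2 g S / weight_sum q z2 g) {S \<in> fsets q. P S}"
    by (rule infsum_strict_partitions)
  also have "\<dots> = infsum (set_weight z2 g) {S \<in> fsets q. P S} / weight_sum q z2 g"
    using infsum_cmult_right'[of "1 / weight_sum q z2 g" "set_weight z2 g"] by simp
  finally show ?thesis .
qed

text \<open>What is extracted from the calibration equations: the first two claims pin the total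
  weight of single parts to \<open>M\<close> once \<open>z2\<close> is small, the third limits the
  weights of small parts, and the last shows that a large \<open>N\<close> needs heavy large
  parts.\<close>

lemma calibrated_bounds:
  assumes cal: "calibrated q N M z1 z2"
  shows "M \<le> z2 * power_theta q g" and "z2 * power_theta q g \<le> (1 + z2) * M"
    and "finite D \<Longrightarrow> D \<subseteq> qpowers q \<Longrightarrow> (\<Sum>l\<in>D. part_weight z2 g l / (1 + part_weight z2 g l)) \<le> M"
    and "N \<le> real (\<Sum>{..L}) + infsum (\<lambda>l. part_weight z2 g l * (if l \<le> L then 0 else real l)) (qpowers q)"
proof -
  have meanM: "infsum (\<lambda>S. set_weight z2 g S * real (card S)) (fsets q) = M * weight_sum q z2 g"
  proof -
    have "M = (\<integral>p. real (length p) \<partial>boltzmann q z1 z2)" using cal by (simp add: calibrated_def)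
    also have "\<dots> = (\<integral>p. real (card (set p)) \<partial>boltzmann q z1 z2)"
      by (intro Bochner_Integration.integral_cong) (auto simp: space_boltzmann strict_partition_stats)
    also have "\<dots> = infsum (\<lambda>S. set_weight z2 g S * real (card S)) (fsets q) / weight_sum q z2 g"
      by (intro boltzmann_integral mean_length) simp
    finally show ?thesis using weight_sum_pos by simp
  qed
  have meanN: "infsum (\<lambda>S. set_weight z2 g S * real (\<Sum>S)) (fsets q) = N * weight_sum q z2 g"
  proof -
    have "N = (\<integral>p. real (weight p) \<partial>boltzmann q z1 z2)" using cal by (simp add: calibrated_def)
    also have "\<dots> = (\<integral>p. real (\<Sum>(set p)) \<partial>boltzmann q z1 z2)"
      by (intro Bochner_Integration.integral_cong) (auto simp: space_boltzmann strict_partition_stats)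
    also have "\<dots> = infsum (\<lambda>S. set_weight z2 g S * real (\<Sum>S)) (fsets q) / weight_sum q z2 g"
      by (intro boltzmann_integral mean_weight) (simp add: sum_nonneg)
    finally show ?thesis using weight_sum_pos by simp
  qed
  show "M \<le> z2 * power_theta q g"
    using mean_length(2) weight_sum_pos by (simp add: meanM)
  show "z2 * power_theta q g \<le> (1 + z2) * M"
    using mean_length(3) weight_sum_pos unfolding meanM by (simp add: mult.assoc [symmetric])
  show "(\<Sum>l\<in>D. part_weight z2 g l / (1 + part_weight z2 g l)) \<le> M" if "finite D" "D \<subseteq> qpowers q"
    using occupation_le_mean_length[OF that] weight_sum_pos unfolding meanM by simp
  show "N \<le> real (\<Sum>{..L}) + infsum (\<lambda>l. part_weight z2 g l * (if l \<le> L then 0 else real l)) (qpowers q)"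
    using mean_weight(2)[of L] weight_sum_pos unfolding meanN by simp
qed

end

section \<open>Forcing the parameters to their limits\<close>

definition low_powers :: "nat \<Rightarrow> nat \<Rightarrow> nat set" where "low_powers q K = (\<lambda>j. j ^ q) ` {1..K}"

lemma low_qpowers:
  assumes "1 \<le> q"
  shows "finite (low_powers q K)" "low_powers q K \<subseteq> qpowers q" "card (low_powers q K) = K" "l \<in> low_powers q K \<Longrightarrow> l \<le> K ^ q"
proof -
  have "inj_on (\<lambda>j::nat. j ^ q) {1..K}" using assms by (auto simp: inj_on_def power_eq_iff_eq_base)
  then show "card (low_powers q K) = K" by (simp add: low_powers_def card_image)
qed (auto simp: low_powers_def qpowers_def intro: power_mono)

text \<open>Each of the \<open>K\<close> smallest parts weighs at least as much as the largest of
  them, \<open>K ^ q\<close>, and \<open>b / (1 + b)\<close> increases with \<open>b\<close>. For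
  large \<open>K\<close> this caps the weight of \<open>K ^ q\<close> without any knowledge of
  \<open>z2\<close>.\<close>

lemma occupation_bound:
  assumes cal: "calibrated q N M z1 z2" and q: "1 \<le> q" and b: "0 \<le> b" "b \<le> z2 * exp (- (- ln z1) * real (K ^ q))"
  shows "real K * (b / (1 + b)) \<le> M"
proof -
  interpret boltzmann_weights q z1 z2
    using cal q by unfold_locales (auto simp: calibrated_def)
  have "b / (1 + b) \<le> part_weight z2 g l / (1 + part_weight z2 g l)" if "l \<in> low_powers q K" for l
  proof -
    have "g * real l \<le> g * real (K ^ q)"
      using low_qpowers(4)[OF q that] g_pos by (intro mult_left_mono) (simp_all only: of_nat_le_iff less_imp_le)
    then have "exp (- g * real (K ^ q)) \<le> exp (- g * real l)" by simp
    then have "b \<le> part_weight z2 g l"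
      using b(2) mult_left_mono[of "exp (- g * real (K ^ q))" "exp (- g * real l)" z2] z2
      unfolding part_weight_def g_def by linarith
    then show ?thesis using b(1) by (simp add: field_simps)
  qed
  then have "(\<Sum>l\<in>low_powers q K. b / (1 + b)) \<le> (\<Sum>l\<in>low_powers q K. part_weight z2 g l / (1 + part_weight z2 g l))"
    by (rule sum_mono)
  also have "\<dots> \<le> M" using calibrated_bounds(3)[OF cal] low_qpowers[OF q] by simp
  finally show ?thesis using low_qpowers(3)[OF q] by simp
qed

text \<open>
  If \<open>- ln z1\<close> stays above \<open>d\<close>, the mean length bounds the weight of some fixed part \<open>L\<close> by 1, so
  larger parts have geometrically decaying weights and the mean weight stays bounded.
\<close>

lemma calibrated_rate_small:
  assumes q: "1 \<le> q" and M: "0 < M" and d: "0 < d"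
  shows "\<exists>C. \<forall>N z1 z2. calibrated q N M z1 z2 \<longrightarrow> C < N \<longrightarrow> - ln z1 < d"
proof -
  \<comment> \<open>With \<open>b = 1\<close> in \<open>occupation_bound\<close>, a weight of at
    least 1 for the part \<open>K ^ q\<close> would give \<open>K / 2 \<le> M\<close>.\<close>
  obtain K :: nat where K: "2 * M < real K" using reals_Archimedean2 by blast
  define L where "L = K ^ q"
  \<comment> \<open>\<open>C\<close> depends on \<open>q\<close>, \<open>M\<close> and
    \<open>d\<close> only: the rate is replaced by its lower bound \<open>d\<close>, and the weight
    of the part \<open>L\<close> by 1.\<close>
  define C where "C = real (\<Sum>{..L}) + exp (d * real L) * infsum (\<lambda>l. exp (- d * real l) * real l) (qpowers q)"
  have "- ln z1 < d" if cal: "calibrated q N M z1 z2" and N: "C < N" for N z1 z2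
  proof (rule ccontr)
    interpret boltzmann_weights q z1 z2
      using cal q by unfold_locales (auto simp: calibrated_def)
    assume "\<not> - ln z1 < d"
    then have gd: "d \<le> g" by (simp add: g_def)
    have small: "z2 * exp (- g * real L) < 1"
    proof (rule ccontr)
      assume "\<not> z2 * exp (- g * real L) < 1"
      then have "real K * (1 / (1 + 1)) \<le> M"
        by (intro occupation_bound[OF cal q]) (auto simp: L_def g_def)
      with K show False by simp
    qed
    have le: "part_weight z2 g l * (if l \<le> L then 0 else real l) \<le> exp (d * real L) * (exp (- d * real l) * real l)" for l
    proof (cases "l \<le> L")
      case False
      have "part_weight z2 g l = z2 * exp (- g * real L) * exp (- g * (real l - real L))"
        by (simp add: part_weight_def exp_add [symmetric] algebra_simps)
      also have "\<dots> \<le> 1 * exp (- g * (real l - real L))"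
        using small by (intro mult_right_mono) auto
      also have "\<dots> \<le> exp (- d * (real l - real L))"
        using False gd by (simp add: mult_right_mono)
      also have "\<dots> = exp (d * real L) * exp (- d * real l)"
        by (simp add: exp_add [symmetric] algebra_simps)
      finally have "part_weight z2 g l * real l \<le> exp (d * real L) * exp (- d * real l) * real l"
        by (rule mult_right_mono) simp
      then show ?thesis using False by (simp add: mult.assoc)
    qed simp
    have summ: "(\<lambda>l. exp (d * real L) * (exp (- d * real l) * real l)) summable_on qpowers q"
      by (intro summable_on_cmult_right exp_weight_summable_on d)
    have "infsum (\<lambda>l. part_weight z2 g l * (if l \<le> L then 0 else real l)) (qpowers q)
        \<le> infsum (\<lambda>l. exp (d * real L) * (exp (- d * real l) * real l)) (qpowers q)"
      by (rule infsum_mono[OF summable_on_comparison_test[OF summ le] summ le])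
         (use part_weight_pos in \<open>auto simp: less_imp_le\<close>)
    also have "\<dots> = exp (d * real L) * infsum (\<lambda>l. exp (- d * real l) * real l) (qpowers q)"
      by (rule infsum_cmult_right')
    finally have "N \<le> C"
      using calibrated_bounds(4)[OF cal, of L] by (simp add: C_def)
    with N show False by simp
  qed
  then show ?thesis by blast
qed

text \<open>The order matters. A small \<open>\<gamma>\<close> makes the weights of finitely many
  fixed parts comparable with \<open>z2\<close>, which forces \<open>z2\<close> to 0, and this
  closes the sandwich of \<open>z2 * power_theta q \<gamma>\<close> between \<open>M\<close> and
  \<open>(1 + z2) * M\<close>. The rate \<open>\<gamma> * t\<close> is the one that a Laplace factor
  produces, with \<open>t = 1 + s\<close>.\<close>

lemma calibrated_limits:
  fixes z1 z2 :: "real \<Rightarrow> real"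
  assumes q: "1 \<le> q" and M: "0 < M" and cal: "\<forall>\<^sub>F N in at_top. calibrated q N M (z1 N) (z2 N)"
  defines "\<gamma> \<equiv> \<lambda>N. - ln (z1 N)"
  shows "filterlim \<gamma> (at_right 0) at_top" and "(z2 \<longlongrightarrow> 0) at_top"
    and "0 < t \<Longrightarrow> ((\<lambda>N. z2 N * power_theta q (\<gamma> N * t)) \<longlongrightarrow> M * t powr (- 1 / real q)) at_top"
proof -
  have gpos: "\<forall>\<^sub>F N in at_top. 0 < \<gamma> N"
    using cal by eventually_elim (simp add: calibrated_def \<gamma>_def)
  have zpos: "\<forall>\<^sub>F N in at_top. 0 < z2 N"
    using cal by eventually_elim (simp add: calibrated_def)
  have gsmall: "\<forall>\<^sub>F N in at_top. \<gamma> N < d" if d: "0 < d" for d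
  proof -
    obtain C where C: "\<And>N z1 z2. calibrated q N M z1 z2 \<Longrightarrow> C < N \<Longrightarrow> - ln z1 < d"
      using calibrated_rate_small[OF q M d] by blast
    show ?thesis
      using cal eventually_gt_at_top[of C] by eventually_elim (auto simp: \<gamma>_def intro: C)
  qed
  have g0: "(\<gamma> \<longlongrightarrow> 0) at_top"
  proof (rule order_tendstoI)
    fix e :: real assume "e < 0"
    then show "\<forall>\<^sub>F N in at_top. e < \<gamma> N" using gpos by (auto elim!: eventually_mono)
  qed (rule gsmall)
  then show glim: "filterlim \<gamma> (at_right 0) at_top"
    using gpos by (intro tendsto_imp_filterlim_at_right) auto
  show z0: "(z2 \<longlongrightarrow> 0) at_top"
  proof (rule order_tendstoI)
    fix e :: real assume "e < 0"
    then show "\<forall>\<^sub>F N in at_top. e < z2 N" using zpos by (auto elim!: eventually_mono)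
  next
    fix e :: real assume e: "0 < e"
    \<comment> \<open>The factor 1/2 is lost to the exponential, which eventually exceeds 1/2 at the
      part \<open>K ^ q\<close>. \<open>K\<close> is then so large that \<open>K\<close> occupation
      numbers of at least \<open>b / (1 + b)\<close> exceed \<open>M\<close>.\<close>
    define b where "b = e / 2"
    have b: "0 < b" using e by (simp add: b_def)
    obtain K :: nat where K: "M / (b / (1 + b)) < real K" using reals_Archimedean2 by blast
    have "((\<lambda>N. exp (- \<gamma> N * real (K ^ q))) \<longlongrightarrow> exp (- 0 * real (K ^ q))) at_top"
      by (intro tendsto_intros g0)
    then have "\<forall>\<^sub>F N in at_top. 1 / 2 < exp (- \<gamma> N * real (K ^ q))"
      by (rule order_tendstoD) simp
    then show "\<forall>\<^sub>F N in at_top. z2 N < e"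
      using cal
    proof eventually_elim
      case (elim N)
      show ?case
      proof (rule ccontr)
        assume "\<not> z2 N < e"
        then have "e * (1 / 2) \<le> z2 N * exp (- \<gamma> N * real (K ^ q))"
          using elim(1) e by (intro mult_mono) auto
        then have "real K * (b / (1 + b)) \<le> M"
          using b by (intro occupation_bound[OF elim(2) q]) (auto simp: b_def \<gamma>_def)
        then show False using K b by (simp add: field_simps)
      qed
    qed
  qed
  have lim1: "((\<lambda>N. z2 N * power_theta q (\<gamma> N)) \<longlongrightarrow> M) at_top"
  proof (rule tendsto_sandwich)
    have bnd: "\<forall>\<^sub>F N in at_top. M \<le> z2 N * power_theta q (\<gamma> N) \<and> z2 N * power_theta q (\<gamma> N) \<le> (1 + z2 N) * M"
      using cal
    proof eventually_elim
      case (elim N)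
      interpret boltzmann_weights q "z1 N" "z2 N"
        using elim q by unfold_locales (auto simp: calibrated_def)
      show ?case using calibrated_bounds(1,2)[OF elim] by (simp add: \<gamma>_def g_def)
    qed
    show "\<forall>\<^sub>F N in at_top. M \<le> z2 N * power_theta q (\<gamma> N)" "\<forall>\<^sub>F N in at_top. z2 N * power_theta q (\<gamma> N) \<le> (1 + z2 N) * M"
      using bnd by (auto elim!: eventually_mono)
    show "((\<lambda>N. (1 + z2 N) * M) \<longlongrightarrow> M) at_top"
      by (rule tendsto_eq_intros z0 refl)+ simp
  qed simp
  show "((\<lambda>N. z2 N * power_theta q (\<gamma> N * t)) \<longlongrightarrow> M * t powr (- 1 / real q)) at_top" if t: "0 < t"
  proof -
    have "((\<lambda>N. z2 N * power_theta q (\<gamma> N) * (power_theta q (t * \<gamma> N) / power_theta q (\<gamma> N))) \<longlongrightarrow> M * t powr (- 1 / real q)) at_top"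
      by (intro tendsto_mult lim1 filterlim_compose[OF power_theta_ratio[OF q t] glim])
    moreover have "\<forall>\<^sub>F N in at_top. z2 N * power_theta q (\<gamma> N) * (power_theta q (t * \<gamma> N) / power_theta q (\<gamma> N)) = z2 N * power_theta q (\<gamma> N * t)"
      using gpos
    proof eventually_elim
      case (elim N)
      then show ?case using power_theta_pos[OF elim q] by (simp add: mult.commute)
    qed
    ultimately show ?thesis by (rule Lim_transform_eventually)
  qed
qed

text \<open>Induction on \<open>m\<close> along the two halves of the recursion; the gap between
  them carries the factor \<open>z\<close>, which tends to 0.\<close>

lemma slice_sum_limit:
  fixes z c :: "'i \<Rightarrow> real"
  assumes q: "1 \<le> q" and pos: "\<forall>\<^sub>F i in F. 0 < z i \<and> 0 < c i"
    and z0: "(z \<longlongrightarrow> 0) F" and lim: "((\<lambda>i. z i * power_theta q (c i)) \<longlongrightarrow> x) F"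
  shows "((\<lambda>i. slice_sum q (z i) (c i) m) \<longlongrightarrow> x ^ m / fact m) F"
proof (induction m)
  case 0
  have "\<forall>\<^sub>F i in F. slice_sum q (z i) (c i) 0 = 1"
    using pos
  proof eventually_elim
    case (elim i)
    interpret partition_weights q "z i" "c i" using elim q by unfold_locales auto
    show ?case using elem_0(2) by (simp add: elem_eq)
  qed
  then show ?case by (simp add: tendsto_cong)
next
  case (Suc m)
  have bnd: "\<forall>\<^sub>F i in F. (z i * power_theta q (c i) - real m * z i) * slice_sum q (z i) (c i) m / real (Suc m) \<le> slice_sum q (z i) (c i) (Suc m)
      \<and> slice_sum q (z i) (c i) (Suc m) \<le> z i * power_theta q (c i) * slice_sum q (z i) (c i) m / real (Suc m)"
    using pos
  proof eventually_elim
    case (elim i)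
    interpret partition_weights q "z i" "c i" using elim q by unfold_locales auto
    show ?case using elem_Suc_le[of m] elem_Suc_ge[of "z i" m] part_weight_le
      by (simp add: elem_eq total_eq field_simps del: of_nat_Suc)
  qed
  show ?case
  proof (rule tendsto_sandwich)
    show "\<forall>\<^sub>F i in F. (z i * power_theta q (c i) - real m * z i) * slice_sum q (z i) (c i) m / real (Suc m) \<le> slice_sum q (z i) (c i) (Suc m)"
      "\<forall>\<^sub>F i in F. slice_sum q (z i) (c i) (Suc m) \<le> z i * power_theta q (c i) * slice_sum q (z i) (c i) m / real (Suc m)"
      using bnd by (auto elim!: eventually_mono)
    have eq: "x ^ Suc m / fact (Suc m) = (x - real m * 0) * (x ^ m / fact m) / real (Suc m)"
      "x ^ Suc m / fact (Suc m) = x * (x ^ m / fact m) / real (Suc m)"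
      by (simp_all add: field_simps)
    show "((\<lambda>i. (z i * power_theta q (c i) - real m * z i) * slice_sum q (z i) (c i) m / real (Suc m)) \<longlongrightarrow> x ^ Suc m / fact (Suc m)) F"
      unfolding eq(1) by (intro tendsto_intros lim z0 Suc) simp
    show "((\<lambda>i. z i * power_theta q (c i) * slice_sum q (z i) (c i) m / real (Suc m)) \<longlongrightarrow> x ^ Suc m / fact (Suc m)) F"
      unfolding eq(2) by (intro tendsto_intros lim Suc) simp
  qed
qed

text \<open>Tannery's theorem, dominated convergence for series, with the kind of dominating series
  that \<open>elem_le\<close> supplies.\<close>

lemma tendsto_sums_exp_bound:
  fixes f :: "'i \<Rightarrow> nat \<Rightarrow> real"
  assumes lim: "\<And>k. ((\<lambda>i. f i k) \<longlongrightarrow> b k) F"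
    and bound: "\<forall>\<^sub>F i in F. \<forall>k. \<bar>f i k\<bar> \<le> C ^ k / fact k"
    and sums: "\<forall>\<^sub>F i in F. f i sums s i" and b: "b sums t" and F: "F \<noteq> bot"
  shows "(s \<longlongrightarrow> t) F"
proof -
  have "\<forall>\<^sub>F (k, i) in at_top \<times>\<^sub>F F. norm (f i k) \<le> C ^ k / fact k"
    unfolding eventually_prod_filter using bound
    by (intro exI[of _ "\<lambda>_. True"] exI[of _ "\<lambda>i. \<forall>k. \<bar>f i k\<bar> \<le> C ^ k / fact k"]) simp
  moreover have "summable (\<lambda>k. C ^ k / fact k)"
    using summable_exp[of C] by (simp add: field_simps)
  ultimately have "((\<lambda>i. suminf (\<lambda>k. f i k)) \<longlongrightarrow> suminf b) F"
    using tannerys_theorem[where a = "\<lambda>k i. f i k" and M = "\<lambda>k. C ^ k / fact k", OF lim _ _ F] by blast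
  moreover have "suminf b = t" using b by (rule sums_unique[symmetric])
  moreover have "\<forall>\<^sub>F i in F. suminf (\<lambda>k. f i k) = s i"
    using sums by eventually_elim (simp add: sums_unique[symmetric])
  ultimately show ?thesis by (simp add: tendsto_cong)
qed

section \<open>Limit laws\<close>

text \<open>The law of the set of parts given the length \<open>m\<close>. Positivity of
  \<open>slice_sum\<close> is established only eventually along the family; should it vanish,
  division by 0 gives the zero measure, so the general claim is a mass of at most 1.\<close>

definition slice_law :: "nat \<Rightarrow> real \<Rightarrow> real \<Rightarrow> nat \<Rightarrow> nat set measure" where
  "slice_law q z c m = point_measure (fsets_card q m) (\<lambda>S. ennreal (set_weight z c S / slice_sum q z c m))"

context partition_weights
begin

lemma slice_sum_nonneg: "0 \<le> slice_sum q z c m"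
  using elem_nonneg by (simp add: elem_eq)

lemma summable_slice_density: "(\<lambda>S. set_weight z c S / slice_sum q z c m) summable_on A" if "A \<subseteq> fsets q"
  using summable_on_cmult_right[OF set_weight_summable[OF that], of "1 / slice_sum q z c m"] by simp

lemma finite_slice_law: "finite_measure (slice_law q z c m)"
  unfolding slice_law_def using set_weight_nonneg[OF z] slice_sum_nonneg
  by (intro finite_point_measure summable_slice_density) auto

lemma measure_slice_law:
  "measure (slice_law q z c m) {S \<in> space (slice_law q z c m). P S}
    = infsum (set_weight z c) {S \<in> fsets_card q m. P S} / slice_sum q z c m"
proof -
  have "measure (slice_law q z c m) {S \<in> space (slice_law q z c m). P S}
      = infsum (\<lambda>S. set_weight z c S / slice_sum q z c m) {S \<in> fsets_card q m. P S}"
    unfolding slice_law_def space_point_measure using set_weight_nonneg[OF z] slice_sum_nonneg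
    by (intro measure_point_measure summable_slice_density) auto
  also have "\<dots> = infsum (set_weight z c) {S \<in> fsets_card q m. P S} / slice_sum q z c m"
    using infsum_cmult_right'[of "1 / slice_sum q z c m" "set_weight z c"] by simp
  finally show ?thesis .
qed

lemma slice_law_le_1: "measure (slice_law q z c m) A \<le> 1"
proof -
  interpret finite_measure "slice_law q z c m" by (rule finite_slice_law)
  have "measure (slice_law q z c m) A \<le> measure (slice_law q z c m) (space (slice_law q z c m))"
    by (rule bounded_measure)
  also have "\<dots> \<le> 1"
    using measure_slice_law[of m "\<lambda>_. True"] by (simp add: slice_sum_def)
  finally show ?thesis .
qed

text \<open>Exponential tilting: the Laplace factor turns the rate \<open>c\<close> into
  \<open>c * (1 + s)\<close> and leaves \<open>z\<close> alone, so that limits of slice sums suffice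
  for limits of Laplace transforms.\<close>

lemma slice_law_laplace:
  assumes s: "0 \<le> s"
  shows "(\<integral>S. exp (- s * (c * real (\<Sum>S))) \<partial>slice_law q z c m) = slice_sum q z (c * (1 + s)) m / slice_sum q z c m"
proof -
  interpret s: partition_weights q z "c * (1 + s)"
    using q z c s by unfold_locales (auto intro: add_pos_nonneg)
  have eq: "set_weight z c S / slice_sum q z c m * exp (- s * (c * real (\<Sum>S))) = 1 / slice_sum q z c m * set_weight z (c * (1 + s)) S" for S
    using set_weight_mult[of z c S "s * c"] by (simp add: algebra_simps)
  have "has_bochner_integral (slice_law q z c m) (\<lambda>S. exp (- s * (c * real (\<Sum>S))))
      (infsum (\<lambda>S. set_weight z c S / slice_sum q z c m * exp (- s * (c * real (\<Sum>S)))) (fsets_card q m))"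
    unfolding slice_law_def
  proof (rule has_bochner_integral_point_measure)
    show "(\<lambda>S. set_weight z c S / slice_sum q z c m * exp (- s * (c * real (\<Sum>S)))) summable_on fsets_card q m"
      unfolding eq by (intro summable_on_cmult_right s.set_weight_summable) auto
  qed (use set_weight_nonneg[OF z] slice_sum_nonneg in auto)
  then show ?thesis
    unfolding eq infsum_cmult_right' by (simp add: has_bochner_integral_iff slice_sum_def)
qed

lemma slice_sum_sums: "(\<lambda>k. infsum (set_weight z c) {S \<in> fsets_card q k. P S}) sums infsum (set_weight z c) {S \<in> fsets q. P S}"
proof -
  let ?f = "\<lambda>S. if P S then set_weight z c S else 0"
  have "?f summable_on fsets q"
    by (rule summable_on_comparison_test[OF set_weight_summable[OF order_refl]]) (use set_weight_nonneg[OF z] in auto)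
  then have "(\<lambda>k. infsum ?f (slice k)) sums infsum ?f (fsets q)"
    by (rule has_sum_slices)
  moreover have "infsum ?f (slice k) = infsum (set_weight z c) {S \<in> fsets_card q k. P S}" for k
    unfolding slice_eq by (rule infsum_cong_neutral) auto
  moreover have "infsum ?f (fsets q) = infsum (set_weight z c) {S \<in> fsets q. P S}"
    by (rule infsum_cong_neutral) auto
  ultimately show ?thesis by simp
qed

text \<open>The bound is the same for every \<open>P\<close>, so one dominating series serves both
  the normalisation and the distribution function.\<close>

lemma infsum_slice_bounds:
  "0 \<le> infsum (set_weight z c) {S \<in> fsets_card q k. P S}"
  "infsum (set_weight z c) {S \<in> fsets_card q k. P S} \<le> (z * power_theta q c) ^ k / fact k"
proof -
  show "0 \<le> infsum (set_weight z c) {S \<in> fsets_card q k. P S}"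
    by (intro infsum_nonneg set_weight_nonneg z)
  have "infsum (set_weight z c) {S \<in> fsets_card q k. P S} \<le> slice_sum q z c k"
    unfolding slice_sum_def by (rule infsum_mono2) (auto intro!: set_weight_summable set_weight_nonneg z)
  then show "infsum (set_weight z c) {S \<in> fsets_card q k. P S} \<le> (z * power_theta q c) ^ k / fact k"
    using elem_le[of k] by (simp add: elem_eq total_eq)
qed

end

section \<open>Limits along a calibrated family\<close>

locale calibrated_family =
  fixes q :: nat and M :: real and z1 z2 :: "real \<Rightarrow> real"
  assumes q: "1 \<le> q" and M: "0 < M"
    and cal: "\<forall>\<^sub>F N in at_top. calibrated q N M (z1 N) (z2 N)"
begin

definition \<gamma> :: "real \<Rightarrow> real" where "\<gamma> N = - ln (z1 N)"

definition law :: "real \<Rightarrow> nat list measure" where "law N = boltzmann q (z1 N) (z2 N)"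

lemma eventually_boltzmann: "\<forall>\<^sub>F N in at_top. boltzmann_weights q (z1 N) (z2 N)"
  using cal by eventually_elim (use q in \<open>auto simp: calibrated_def boltzmann_weights_def\<close>)

lemma eventually_weights: "\<forall>\<^sub>F N in at_top. partition_weights q (z2 N) (\<gamma> N)"
  using cal by eventually_elim (use q in \<open>auto simp: calibrated_def partition_weights_def \<gamma>_def\<close>)

lemma total_limit:
  "0 < t \<Longrightarrow> ((\<lambda>N. z2 N * power_theta q (\<gamma> N * t)) \<longlongrightarrow> M * t powr (- 1 / real q)) at_top"
  unfolding \<gamma>_def using calibrated_limits(3)[OF q M cal] by simp

lemma slice_sum_lim:
  assumes "0 < t"
  shows "((\<lambda>N. slice_sum q (z2 N) (\<gamma> N * t) m) \<longlongrightarrow> (M * t powr (- 1 / real q)) ^ m / fact m) at_top"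
proof (rule slice_sum_limit[OF q _ calibrated_limits(2)[OF q M cal] total_limit[OF assms]])
  show "\<forall>\<^sub>F N in at_top. 0 < z2 N \<and> 0 < \<gamma> N * t"
    using cal by eventually_elim (use assms in \<open>auto simp: calibrated_def \<gamma>_def mult_less_0_iff\<close>)
qed

lemma slice_sum_lim_1: "((\<lambda>N. slice_sum q (z2 N) (\<gamma> N) m) \<longlongrightarrow> M ^ m / fact m) at_top"
  using slice_sum_lim[of 1 m] by simp

lemma eventually_El_pos: "\<forall>\<^sub>F N in at_top. 0 < slice_sum q (z2 N) (\<gamma> N) m"
  using slice_sum_lim_1[of m] by (rule order_tendstoD) (use M in simp)

text \<open>For \<open>m \<ge> 1\<close> the gamma law has no atoms, so
  \<open>laplace_continuity\<close> applies at every \<open>x\<close>. The factor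
  \<open>M ^ m / fact m\<close> cancels in the quotient of slice sums.\<close>

lemma slice_law_limit:
  assumes m: "1 \<le> m"
  shows "((\<lambda>N. measure (slice_law q (z2 N) (\<gamma> N) m)
      {S \<in> space (slice_law q (z2 N) (\<gamma> N) m). \<gamma> N * real (\<Sum>S) \<le> x}) \<longlongrightarrow> cdf (gamma_kernel q m) x) at_top"
proof (rule laplace_continuity)
  have dist: "nonneg_distribution (gamma_kernel q m)" by (rule nonneg_distribution_gamma_kernel[OF q])
  then interpret real_distribution "gamma_kernel q m" by (simp add: nonneg_distribution_def)
  show "finite_borel_measure (gamma_kernel q m)" by (rule finite_borel_measure_M)
  show "AE x in gamma_kernel q m. 0 \<le> x" by (rule nonneg_distribution_AE[OF dist])
  show "measure (gamma_kernel q m) {x} = 0"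
    using m q by (simp add: gamma_kernel_def measure_gamma_measure_singleton)
  show "\<forall>\<^sub>F N in at_top. finite_measure (slice_law q (z2 N) (\<gamma> N) m)
      \<and> (\<lambda>S. \<gamma> N * real (\<Sum>S)) \<in> borel_measurable (slice_law q (z2 N) (\<gamma> N) m)
      \<and> (AE S in slice_law q (z2 N) (\<gamma> N) m. 0 \<le> \<gamma> N * real (\<Sum>S))"
    using eventually_weights
  proof eventually_elim
    case (elim N)
    interpret partition_weights q "z2 N" "\<gamma> N" by fact
    have "(\<lambda>S. \<gamma> N * real (\<Sum>S)) \<in> borel_measurable (slice_law q (z2 N) (\<gamma> N) m)"
      by (simp add: slice_law_def)
    moreover have "AE S in slice_law q (z2 N) (\<gamma> N) m. 0 \<le> \<gamma> N * real (\<Sum>S)"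
      using c by (intro AE_I2 mult_nonneg_nonneg) (simp_all only: of_nat_0_le_iff less_imp_le)
    ultimately show ?case using finite_slice_law by blast
  qed
  fix k :: nat
  have "((\<lambda>N. slice_sum q (z2 N) (\<gamma> N * (1 + real k)) m / slice_sum q (z2 N) (\<gamma> N) m)
      \<longlongrightarrow> ((M * (1 + real k) powr (- 1 / real q)) ^ m / fact m) / (M ^ m / fact m)) at_top"
    using M by (intro tendsto_divide slice_sum_lim slice_sum_lim_1) auto
  also have "((M * (1 + real k) powr (- 1 / real q)) ^ m / fact m) / (M ^ m / fact m) = laplace (gamma_kernel q m) (real k)"
    using M by (subst laplace_gamma_kernel[OF q]) (simp_all add: power_mult_distrib)
  finally show "((\<lambda>N. \<integral>S. exp (- real k * (\<gamma> N * real (\<Sum>S))) \<partial>slice_law q (z2 N) (\<gamma> N) m)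
      \<longlongrightarrow> laplace (gamma_kernel q m) (real k)) at_top"
  proof (rule Lim_transform_eventually)
    show "\<forall>\<^sub>F N in at_top. slice_sum q (z2 N) (\<gamma> N * (1 + real k)) m / slice_sum q (z2 N) (\<gamma> N) m
        = (\<integral>S. exp (- real k * (\<gamma> N * real (\<Sum>S))) \<partial>slice_law q (z2 N) (\<gamma> N) m)"
      using eventually_weights by eventually_elim (simp only: partition_weights.slice_law_laplace of_nat_0_le_iff)
  qed
qed

text \<open>The unnormalised probability of having length \<open>k\<close> and scaled weight at most
  \<open>x\<close>.\<close>

definition joint :: "real \<Rightarrow> nat \<Rightarrow> real \<Rightarrow> real" where
  "joint x k N = infsum (set_weight (z2 N) (\<gamma> N)) {S \<in> fsets_card q k. \<gamma> N * real (\<Sum>S) \<le> x}"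

lemma joint_limit: "(joint x k \<longlongrightarrow> M ^ k / fact k * cdf (gamma_kernel q k) x) at_top"
proof (cases "k = 0")
  \<comment> \<open>Without parts the scaled weight is 0 for every \<open>N\<close>, so the sequence
    is constant and converges even at the atom \<open>x = 0\<close>, which
    \<open>laplace_continuity\<close> does not reach.\<close>
  case True
  have "joint x k = (\<lambda>_. if 0 \<le> x then 1 else 0)"
  proof
    fix N
    have "{S \<in> fsets_card q k. \<gamma> N * real (\<Sum>S) \<le> x} = (if 0 \<le> x then {{}} else {})"
      using True by (auto simp: Fpow_def)
    then show "joint x k N = (if 0 \<le> x then 1 else 0)" by (simp add: joint_def set_weight_def)
  qed
  moreover have "cdf (gamma_kernel q k) x = (if 0 \<le> x then 1 else 0)"
    using True by (simp add: gamma_kernel_def cdf_def measure_return)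
  ultimately show ?thesis using True by (simp add: tendsto_const)
next
  case False
  then have "((\<lambda>N. slice_sum q (z2 N) (\<gamma> N) k * measure (slice_law q (z2 N) (\<gamma> N) k)
      {S \<in> space (slice_law q (z2 N) (\<gamma> N) k). \<gamma> N * real (\<Sum>S) \<le> x})
      \<longlongrightarrow> M ^ k / fact k * cdf (gamma_kernel q k) x) at_top"
    by (intro tendsto_mult slice_sum_lim_1 slice_law_limit) simp
  moreover have "\<forall>\<^sub>F N in at_top. slice_sum q (z2 N) (\<gamma> N) k * measure (slice_law q (z2 N) (\<gamma> N) k)
      {S \<in> space (slice_law q (z2 N) (\<gamma> N) k). \<gamma> N * real (\<Sum>S) \<le> x} = joint x k N"
    using eventually_weights eventually_El_pos[of k]
    by eventually_elim (simp add: partition_weights.measure_slice_law joint_def)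
  ultimately show ?thesis by (rule Lim_transform_eventually)
qed

lemma eventually_total_le: "\<forall>\<^sub>F N in at_top. z2 N * power_theta q (\<gamma> N) < M + 1"
proof -
  have "((\<lambda>N. z2 N * power_theta q (\<gamma> N)) \<longlongrightarrow> M) at_top" using total_limit[of 1] by simp
  then show ?thesis by (rule order_tendstoD) simp
qed

text \<open>Limit and sum over the lengths are interchanged for a predicate that may vary with
  \<open>N\<close>. The constant \<open>M + 1\<close> is an eventual bound on the total weight of
  single parts, whose limit is \<open>M\<close>.\<close>

lemma slices_limit:
  assumes lim: "\<And>k. ((\<lambda>N. infsum (set_weight (z2 N) (\<gamma> N)) {S \<in> fsets_card q k. P N S}) \<longlongrightarrow> b k) at_top"
    and b: "b sums t"
  shows "((\<lambda>N. infsum (set_weight (z2 N) (\<gamma> N)) {S \<in> fsets q. P N S}) \<longlongrightarrow> t) at_top"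
proof (rule tendsto_sums_exp_bound[OF lim _ _ b])
  show "\<forall>\<^sub>F N in at_top. \<forall>k. \<bar>infsum (set_weight (z2 N) (\<gamma> N)) {S \<in> fsets_card q k. P N S}\<bar> \<le> (M + 1) ^ k / fact k"
    using eventually_weights eventually_total_le
  proof eventually_elim
    case (elim N)
    interpret partition_weights q "z2 N" "\<gamma> N" by fact
    have "(z2 N * power_theta q (\<gamma> N)) ^ k / fact k \<le> (M + 1) ^ k / fact k" for k
      using elim(2) z power_theta_pos[OF c q] by (intro divide_right_mono power_mono) auto
    then show ?case
      using infsum_slice_bounds[where P = "P N"] by (auto intro: order_trans)
  qed
  show "\<forall>\<^sub>F N in at_top. (\<lambda>k. infsum (set_weight (z2 N) (\<gamma> N)) {S \<in> fsets_card q k. P N S})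
      sums infsum (set_weight (z2 N) (\<gamma> N)) {S \<in> fsets q. P N S}"
    using eventually_weights by eventually_elim (rule partition_weights.slice_sum_sums)
qed simp

lemma weight_sum_limit: "((\<lambda>N. weight_sum q (z2 N) (\<gamma> N)) \<longlongrightarrow> exp M) at_top"
proof -
  have "((\<lambda>N. infsum (set_weight (z2 N) (\<gamma> N)) {S \<in> fsets q. True}) \<longlongrightarrow> exp M) at_top"
  proof (rule slices_limit)
    show "((\<lambda>N. infsum (set_weight (z2 N) (\<gamma> N)) {S \<in> fsets_card q k. True}) \<longlongrightarrow> M ^ k / fact k) at_top" for k
      using slice_sum_lim_1[of k] by (simp add: slice_sum_def)
    show "(\<lambda>k. M ^ k / fact k) sums exp M"
      using exp_converges[of M] by (simp add: field_simps)
  qed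
  then show ?thesis by (simp add: weight_sum_def)
qed

text \<open>The quantifier over \<open>Q\<close> stands inside the eventuality, so that one
  threshold on \<open>N\<close> serves all \<open>x\<close> at once; the uniform limit in
  \<open>conditional_limit\<close> relies on this.\<close>

lemma prob_eq:
  "\<forall>\<^sub>F N in at_top. \<forall>Q. measure (law N) {p \<in> space (law N). Q (length p) (weight p)}
    = infsum (set_weight (z2 N) (\<gamma> N)) {S \<in> fsets q. Q (card S) (\<Sum>S)} / weight_sum q (z2 N) (\<gamma> N)"
  using eventually_boltzmann
proof eventually_elim
  case (elim N)
  then interpret boltzmann_weights q "z1 N" "z2 N" .
  have "g = \<gamma> N" by (simp add: g_def \<gamma>_def)
  then show ?case unfolding law_def
    by (intro allI boltzmann_prob[where P = "\<lambda>S. Q (card S) (\<Sum>S)" for Q, unfolded \<open>g = \<gamma> N\<close>])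
       (simp add: strict_partition_stats)
qed

lemma length_limit: "((\<lambda>N. \<P>(p in law N. length p = m)) \<longlongrightarrow> M ^ m * exp (- M) / fact m) at_top"
proof -
  have "((\<lambda>N. slice_sum q (z2 N) (\<gamma> N) m / weight_sum q (z2 N) (\<gamma> N)) \<longlongrightarrow> M ^ m / fact m / exp M) at_top"
    by (intro tendsto_divide slice_sum_lim_1 weight_sum_limit) simp
  moreover have "\<forall>\<^sub>F N in at_top. slice_sum q (z2 N) (\<gamma> N) m / weight_sum q (z2 N) (\<gamma> N) = \<P>(p in law N. length p = m)"
    using prob_eq
  proof eventually_elim
    case (elim N)
    then show ?case using elim[rule_format, of "\<lambda>n _. n = m"] by (simp add: slice_sum_def)
  qed
  ultimately show ?thesis
    by (simp add: Lim_transform_eventually exp_minus field_simps)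
qed

lemma conditional_prob_eq:
  assumes m: "1 \<le> m"
  shows "\<forall>\<^sub>F N in at_top. \<forall>x. \<P>(p in law N. \<gamma> N * real (weight p) \<le> x \<bar> length p = m)
    = measure (slice_law q (z2 N) (\<gamma> N) m) {S \<in> space (slice_law q (z2 N) (\<gamma> N) m). \<gamma> N * real (\<Sum>S) \<le> x}"
  using prob_eq eventually_weights
proof eventually_elim
  case (elim N)
  interpret partition_weights q "z2 N" "\<gamma> N" by fact
  have "{S \<in> fsets q. \<gamma> N * real (\<Sum>S) \<le> x \<and> card S = m} = {S \<in> fsets_card q m. \<gamma> N * real (\<Sum>S) \<le> x}" for x
    by auto
  then show ?case
    using weight_sum_pos elim(1)[rule_format, of "\<lambda>n _. n = m"] elim(1)[rule_format, of "\<lambda>n w. \<gamma> N * real w \<le> x \<and> n = m" for x]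
    by (simp add: cond_prob_def measure_slice_law slice_sum_def)
qed

lemma conditional_limit:
  assumes m: "1 \<le> m"
  shows "uniform_limit {0..} (\<lambda>N x. \<P>(p in law N. \<gamma> N * real (weight p) \<le> x \<bar> length p = m))
    (gamma_cdf (real m / real q)) at_top"
proof -
  let ?a = "real m / real q"
  let ?f = "\<lambda>N x. measure (slice_law q (z2 N) (\<gamma> N) m) {S \<in> space (slice_law q (z2 N) (\<gamma> N) m). \<gamma> N * real (\<Sum>S) \<le> x}"
  have a: "0 < ?a" using m q by simp
  interpret real_distribution "gamma_measure ?a" by (rule real_distribution_gamma_measure[OF a])
  have ker: "gamma_kernel q m = gamma_measure ?a" using m by (simp add: gamma_kernel_def)
  have "uniform_limit {0..} ?f (cdf (gamma_measure ?a)) at_top"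
  proof (rule uniform_limit_of_mono)
    show "\<forall>\<^sub>F N in at_top. mono (?f N) \<and> (\<forall>x. ?f N x \<le> 1)"
      using eventually_weights
    proof eventually_elim
      case (elim N)
      interpret partition_weights q "z2 N" "\<gamma> N" by fact
      interpret law: finite_measure "slice_law q (z2 N) (\<gamma> N) m" by (rule finite_slice_law)
      have "mono (?f N)"
        by (intro monoI law.finite_measure_mono) (auto simp: slice_law_def space_point_measure sets_point_measure)
      then show ?case using slice_law_le_1 by blast
    qed
    show "((\<lambda>N. ?f N x) \<longlongrightarrow> cdf (gamma_measure ?a) x) at_top" for x
      using slice_law_limit[OF m] by (simp add: ker)
    show "continuous_on {0..} (cdf (gamma_measure ?a))"
      using a by (intro continuous_at_imp_continuous_on) (simp add: isCont_cdf measure_gamma_measure_singleton)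
    show "mono_on {0..} (cdf (gamma_measure ?a))"
      by (intro mono_onI cdf_nondecreasing)
    show "(cdf (gamma_measure ?a) \<longlongrightarrow> 1) at_top" by (rule cdf_lim_at_top_prob)
  qed
  moreover have "uniform_limit {0..} ?f (cdf (gamma_measure ?a)) at_top \<longleftrightarrow>
     uniform_limit {0..} (\<lambda>N x. \<P>(p in law N. \<gamma> N * real (weight p) \<le> x \<bar> length p = m)) (gamma_cdf ?a) at_top"
  proof (rule uniform_limit_cong)
    show "\<forall>\<^sub>F N in at_top. \<forall>x\<in>{0..}. ?f N x = \<P>(p in law N. \<gamma> N * real (weight p) \<le> x \<bar> length p = m)"
      using conditional_prob_eq[OF m] by eventually_elim simp
    show "cdf (gamma_measure ?a) x = gamma_cdf ?a x" if "x \<in> {0..}" for x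
      using that cdf_gamma_measure[OF a] by simp
  qed
  ultimately show ?thesis by blast
qed

text \<open>Every \<open>x\<close> is covered, the atom 0 included, because each slice converges at
  every \<open>x\<close>. The factor \<open>exp M\<close> of the unnormalised limit is divided out
  by the limit of \<open>weight_sum\<close>.\<close>

lemma weight_limit:
  "((\<lambda>N. \<P>(p in law N. \<gamma> N * real (weight p) \<le> x)) \<longlongrightarrow> cdf (compound_measure q M) x) at_top"
proof -
  have "((\<lambda>N. infsum (set_weight (z2 N) (\<gamma> N)) {S \<in> fsets q. \<gamma> N * real (\<Sum>S) \<le> x})
      \<longlongrightarrow> exp M * cdf (compound_measure q M) x) at_top"
  proof (rule slices_limit)
    show "((\<lambda>N. infsum (set_weight (z2 N) (\<gamma> N)) {S \<in> fsets_card q k. \<gamma> N * real (\<Sum>S) \<le> x})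
        \<longlongrightarrow> M ^ k / fact k * cdf (gamma_kernel q k) x) at_top" for k
      using joint_limit[of x k] by (simp add: joint_def[abs_def])
    have "(\<lambda>k. exp M * (pmf (poisson_pmf M) k * cdf (gamma_kernel q k) x)) sums (exp M * cdf (compound_measure q M) x)"
      unfolding cdf_def by (intro sums_mult measure_compound_sums[OF q]) simp
    moreover have "(\<lambda>k. exp M * (pmf (poisson_pmf M) k * cdf (gamma_kernel q k) x)) = (\<lambda>k. M ^ k / fact k * cdf (gamma_kernel q k) x)"
      using M by (simp add: fun_eq_iff exp_minus field_simps)
    ultimately show "(\<lambda>k. M ^ k / fact k * cdf (gamma_kernel q k) x) sums (exp M * cdf (compound_measure q M) x)"
      by simp
  qed
  then have "((\<lambda>N. infsum (set_weight (z2 N) (\<gamma> N)) {S \<in> fsets q. \<gamma> N * real (\<Sum>S) \<le> x} / weight_sum q (z2 N) (\<gamma> N))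
      \<longlongrightarrow> exp M * cdf (compound_measure q M) x / exp M) at_top"
    by (intro tendsto_divide weight_sum_limit) auto
  moreover have "\<forall>\<^sub>F N in at_top. infsum (set_weight (z2 N) (\<gamma> N)) {S \<in> fsets q. \<gamma> N * real (\<Sum>S) \<le> x} / weight_sum q (z2 N) (\<gamma> N)
      = \<P>(p in law N. \<gamma> N * real (weight p) \<le> x)"
    using prob_eq
  proof eventually_elim
    case (elim N)
    then show ?case using elim[rule_format, of "\<lambda>_ w. \<gamma> N * real w \<le> x"] by simp
  qed
  ultimately show ?thesis by (simp add: Lim_transform_eventually)
qed

text \<open>The empty partition is subtracted from the unconditional law. Having weight 0, it
  belongs to the event "scaled weight at most \<open>x\<close>" exactly when
  \<open>x \<ge> 0\<close>, which is what \<open>?e\<close> encodes.\<close>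

lemma positive_weight_limit:
  defines "\<mu> \<equiv> compound_measure q M"
  shows "((\<lambda>N. \<P>(p in law N. \<gamma> N * real (weight p) \<le> x \<bar> length p > 0))
    \<longlongrightarrow> (if x < 0 then 0 else (cdf \<mu> x - exp (- M)) / (1 - exp (- M)))) at_top"
proof -
  let ?e = "if x < 0 then 0 else 1 :: real"
  let ?p = "\<lambda>N. \<P>(p in law N. \<gamma> N * real (weight p) \<le> x)"
  let ?r = "\<lambda>N. \<P>(p in law N. length p = 0)"
  have p0: "(?r \<longlongrightarrow> exp (- M)) at_top" using length_limit[of 0] by simp
  have "((\<lambda>N. (?p N - ?e * ?r N) / (1 - ?r N)) \<longlongrightarrow> (cdf \<mu> x - ?e * exp (- M)) / (1 - exp (- M))) at_top"
    unfolding \<mu>_def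
  proof (rule tendsto_divide)
    show "((\<lambda>N. ?p N - ?e * ?r N) \<longlongrightarrow> cdf (compound_measure q M) x - ?e * exp (- M)) at_top"
      by (rule tendsto_diff[OF weight_limit tendsto_mult[OF tendsto_const p0]])
    show "((\<lambda>N. 1 - ?r N) \<longlongrightarrow> 1 - exp (- M)) at_top"
      by (rule tendsto_diff[OF tendsto_const p0])
  qed (use M in simp)
  moreover have "\<forall>\<^sub>F N in at_top. (?p N - ?e * ?r N) / (1 - ?r N)
      = \<P>(p in law N. \<gamma> N * real (weight p) \<le> x \<bar> length p > 0)"
    using eventually_boltzmann
  proof eventually_elim
    case (elim N)
    then interpret boltzmann_weights q "z1 N" "z2 N" .
    have sets: "A \<in> sets (law N)" if "A \<subseteq> space (law N)" for A
      using that by (simp add: law_def boltzmann_def space_point_measure sets_point_measure)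
    have "measure (law N) (space (law N)) = infsum (set_weight (z2 N) g) {S \<in> fsets q. True} / weight_sum q (z2 N) g"
      using boltzmann_prob[of "\<lambda>_. True" "\<lambda>_. True"] by (simp add: law_def)
    then have one: "measure (law N) (space (law N)) = 1"
      using weight_sum_pos by (simp add: weight_sum_def)
    interpret L: finite_measure "law N"
      unfolding law_def boltzmann_eq using weight_sum_pos set_weight_nonneg[OF z2]
        summable_on_cmult_right[OF summable_strict_partitions[OF set_weight_summable[OF order_refl]], of "1 / weight_sum q (z2 N) g"]
      by (intro finite_point_measure) auto
    have split: "\<P>(p in law N. Q p \<and> length p > 0) = \<P>(p in law N. Q p) - \<P>(p in law N. Q p \<and> length p = 0)" for Q
    proof -
      have "{p \<in> space (law N). Q p \<and> length p > 0}
          = {p \<in> space (law N). Q p} - {p \<in> space (law N). Q p \<and> length p = 0}" by auto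
      then show ?thesis by (simp only:) (rule L.finite_measure_Diff; auto intro: sets)
    qed
    have "{p \<in> space (law N). \<gamma> N * real (weight p) \<le> x \<and> length p = 0}
        = (if x < 0 then {} else {p \<in> space (law N). length p = 0})"
      by (auto simp: weight_def)
    then have "\<P>(p in law N. \<gamma> N * real (weight p) \<le> x \<and> length p = 0) = ?e * ?r N" by simp
    moreover have "\<P>(p in law N. length p > 0) = 1 - ?r N"
      using split[of "\<lambda>_. True"] one by simp
    ultimately show ?case
      using split[of "\<lambda>p. \<gamma> N * real (weight p) \<le> x"] by (simp add: cond_prob_def)
  qed
  ultimately have "((\<lambda>N. \<P>(p in law N. \<gamma> N * real (weight p) \<le> x \<bar> length p > 0))
    \<longlongrightarrow> (cdf \<mu> x - ?e * exp (- M)) / (1 - exp (- M))) at_top"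
    by (rule Lim_transform_eventually)
  moreover have "cdf \<mu> x = 0" if "x < 0"
  proof -
    have nd: "nonneg_distribution \<mu>" unfolding \<mu>_def by (rule nonneg_distribution_compound[OF q])
    then interpret real_distribution \<mu> by (simp add: nonneg_distribution_def)
    have "measure \<mu> {..x} \<le> measure \<mu> {..<0}"
      using that by (intro finite_measure_mono) auto
    then show ?thesis using nd by (simp add: cdf_def nonneg_distribution_def measure_le_0_iff)
  qed
  ultimately show ?thesis by (auto split: if_splits)
qed

end

theorem theorem4p1:
  fixes q :: nat and M :: real and z1 z2 :: "real \<Rightarrow> real"
  assumes "1 \<le> q" and "0 < M"
    and "\<forall>\<^sub>F N in at_top. calibrated q N M (z1 N) (z2 N)"
  defines "P \<equiv> \<lambda>N. boltzmann q (z1 N) (z2 N)"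
    and "\<gamma> \<equiv> \<lambda>N. - ln (z1 N)"
  shows
    "(\<forall>m::nat. ((\<lambda>N. \<P>(p in P N. length p = m))
        \<longlongrightarrow> M ^ m * exp (- M) / fact m) at_top)
   \<and> (\<forall>m::nat. m \<ge> 1 \<longrightarrow> uniform_limit {0..}
        (\<lambda>N x. \<P>(p in P N. \<gamma> N * real (weight p) \<le> x \<bar> length p = m))
        (gamma_cdf (real m / real q)) at_top)
   \<and> (\<exists>\<mu>. nonneg_distribution \<mu>
        \<and> (\<forall>x. ((\<lambda>N. \<P>(p in P N. \<gamma> N * real (weight p) \<le> x)) \<longlongrightarrow> cdf \<mu> x) at_top)
        \<and> cdf \<mu> 0 = exp (- M) \<and> measure \<mu> {0} = exp (- M)
        \<and> (\<forall>s\<ge>0. laplace \<mu> s = exp (- M * (1 - (1 + s) powr (- 1 / real q))))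
        \<and> (\<forall>\<mu>'. nonneg_distribution \<mu>'
              \<and> (\<forall>s\<ge>0. laplace \<mu>' s = exp (- M * (1 - (1 + s) powr (- 1 / real q))))
              \<longrightarrow> \<mu>' = \<mu>))
   \<and> (\<exists>\<mu>. nonneg_distribution \<mu>
        \<and> (\<forall>x. ((\<lambda>N. \<P>(p in P N. \<gamma> N * real (weight p) \<le> x \<bar> length p > 0))
              \<longlongrightarrow> cdf \<mu> x) at_top)
        \<and> (\<forall>s\<ge>0. laplace \<mu> s =
              exp (- M) / (1 - exp (- M)) * (exp (M / (1 + s) powr (1 / real q)) - 1)))"
proof -
  interpret calibrated_family q M z1 z2
    using assms(1-3) by unfold_locales
  let ?\<mu> = "compound_measure q M"
  have P: "P = law" and \<gamma>: "\<gamma> = local.\<gamma>"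
    by (simp_all add: P_def law_def assms(5) calibrated_family.\<gamma>_def[OF calibrated_family_axioms] fun_eq_iff)
  let ?\<phi> = "\<lambda>s. exp (- M * (1 - (1 + s) powr (- 1 / real q)))"
  \<comment> \<open>Positive length corresponds in the limit to a positive scaled weight, because
    the atom of the limit law at 0 equals the limiting probability of the empty partition.\<close>
  let ?\<kappa> = "uniform_measure ?\<mu> {0<..}"
  have \<mu>: "nonneg_distribution ?\<mu>" "measure ?\<mu> {0} = exp (- M)" "cdf ?\<mu> 0 = exp (- M)"
    "\<And>s. 0 \<le> s \<Longrightarrow> laplace ?\<mu> s = ?\<phi> s"
    using nonneg_distribution_compound[OF q] measure_compound_0[OF q M] cdf_compound_0[OF q M]
      laplace_compound[OF q M] by blast+
  have unique: "\<nu> = ?\<mu>" if "nonneg_distribution \<nu> \<and> (\<forall>s\<ge>0. laplace \<nu> s = ?\<phi> s)" for \<nu>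
    using that \<mu> by (intro laplace_unique) auto
  have lt1: "measure ?\<mu> {0} < 1" using M by (simp add: \<mu>(2))
  note \<kappa> = conditioned_distribution[OF \<mu>(1) lt1, unfolded \<mu>(2)]
  have \<kappa>_laplace: "laplace ?\<kappa> s = exp (- M) / (1 - exp (- M)) * (exp (M / (1 + s) powr (1 / real q)) - 1)"
    if s: "0 \<le> s" for s
  proof -
    \<comment> \<open>The factor \<open>exp (- M)\<close> split off here is also the atom that
      \<open>conditioned_distribution\<close> subtracts, which leaves the difference of an
      exponential and 1.\<close>
    have "?\<phi> s = exp (- M) * exp (M / (1 + s) powr (1 / real q))"
      by (simp add: powr_minus algebra_simps divide_inverse flip: exp_add)
    then show ?thesis using \<kappa>(3)[OF s] \<mu>(4)[OF s] by (simp add: algebra_simps diff_divide_distrib)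
  qed
  have \<kappa>_limit: "((\<lambda>N. \<P>(p in law N. local.\<gamma> N * real (weight p) \<le> x \<bar> length p > 0)) \<longlongrightarrow> cdf ?\<kappa> x) at_top" for x
    unfolding \<kappa>(2) by (rule positive_weight_limit)
  show ?thesis
    unfolding P \<gamma>
    by (rule conjI[OF _ conjI[OF _ conjI[OF exI[of _ ?\<mu>] exI[of _ ?\<kappa>]]]]; intro conjI allI impI;
        rule length_limit conditional_limit weight_limit \<kappa>_limit \<mu> unique \<kappa>(1) \<kappa>_laplace; assumption)
qed

end
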